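(* For any fixed real number $\alpha$ with $1/6\le \alpha\le 1/4$ and sufficiently large $n$, $$r(B_{\lceil\alpha n\rceil}, B_n)\le\left(\tfrac32+3\alpha\right) n+o(n).$$ Moreover, the inequality is asymptotically tight when $\alpha=1/6$ or $\alpha=1/4$, i.e., for each of these two values of $\alpha$ one has $r(B_{\lceil\alpha n\rceil}, B_n)=\left(\tfrac32+3\alpha\right) n+o(n)$. Here $o(n)$ denotes a quantity whose ratio to $n$ tends to $0$ as $n\to\infty$ with $\alpha$ fixed.
   Context: For graphs $G$ and $H$, the Ramsey number $r(G,H)$ is the smallest positive integer $N$ such that any red/blue edge coloring of the complete graph $K_N$ contains either a red copy of $G$ or a blue copy of $H$ (as a not necessarily induced subgraph). The book $B_m$ is the graph consisting of $m$ triangles all sharing a common edge (so it has $m+2$ vertices). The paper omits ceiling signs, writing $B_{\alpha n}$ for $B_{\lceil\alpha n\rceil}$. *)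

theory Defs
  imports Complex_Main "HOL-Library.Ramsey" "HOL-Library.Landau_Symbols"
begin

text \<open>A simple graph is given by its vertex set and its edge set, whose members are
  two-element sets of vertices.\<close>

type_synonym 'a graph = "'a set \<times> 'a set set"

definition simple_graph :: "'a graph \<Rightarrow> bool" where
  "simple_graph G \<longleftrightarrow> finite (fst G) \<and> snd G \<subseteq> nsets (fst G) 2"

text \<open>The copy need not be induced: only edges have to be preserved.\<close>

definition contains_copy :: "'a graph \<Rightarrow> 'b graph \<Rightarrow> bool" where
  "contains_copy K G \<longleftrightarrow>
     (\<exists>f. inj_on f (fst G) \<and> f ` fst G \<subseteq> fst K \<and> (\<forall>e \<in> snd G. f ` e \<in> snd K))"

text \<open>A red/blue colouring of the edges of the complete graph on \<open>{..<N}\<close> is given by its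
  set \<open>R\<close> of red edges; all the other edges are blue.\<close>

definition ramsey_arrows :: "nat \<Rightarrow> 'a graph \<Rightarrow> 'b graph \<Rightarrow> bool" where
  "ramsey_arrows N G H \<longleftrightarrow>
     (\<forall>R \<subseteq> nsets {..<N} 2.
        contains_copy ({..<N}, R) G \<or> contains_copy ({..<N}, nsets {..<N} 2 - R) H)"

definition ramsey_number :: "'a graph \<Rightarrow> 'b graph \<Rightarrow> nat" where
  "ramsey_number G H = (LEAST N. 0 < N \<and> ramsey_arrows N G H)"

text \<open>The book with \<open>m\<close> pages: the common edge of the triangles is \<open>{0, 1}\<close>, and their
  third vertices are \<open>2, \<dots>, m + 1\<close>.\<close>

definition book :: "nat \<Rightarrow> nat graph" where
  "book m = ({..<m + 2}, insert {0, 1} (\<Union>i \<in> {2..<m + 2}. {{0, i}, {1, i}}))"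

lemma simple_graph_book: "simple_graph (book m)"
  by (auto simp: simple_graph_def book_def nsets_def card_insert_if)

lemma contains_copy_clique:
  assumes G: "simple_graph G" and A: "A \<subseteq> fst K" "card A = card (fst G)" "finite A"
    and clique: "nsets A 2 \<subseteq> snd K"
  shows "contains_copy K G"
proof -
  have fin: "finite (fst G)" using G by (simp add: simple_graph_def)
  obtain f where f: "bij_betw f (fst G) A"
    using finite_same_card_bij[OF fin A(3)] A(2) by auto
  have "f ` e \<in> snd K" if "e \<in> snd G" for e
  proof -
    have e: "e \<subseteq> fst G" "finite e" "card e = 2"
      using that G by (auto simp: simple_graph_def nsets_def)
    have "inj_on f e" using f e(1) by (meson bij_betw_def inj_on_subset)
    then have "f ` e \<in> nsets A 2"
      using e f by (auto simp: nsets_def card_image bij_betw_def)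
    then show ?thesis using clique by blast
  qed
  then show ?thesis
    unfolding contains_copy_def using f A(1) by (metis bij_betw_def)
qed

text \<open>By Ramsey's theorem, the least number in the definition of \<open>ramsey_number\<close> exists.\<close>

lemma ramsey_number_arrows:
  assumes "simple_graph G" "simple_graph H"
  shows "0 < ramsey_number G H \<and> ramsey_arrows (ramsey_number G H) G H"
proof -
  obtain r where r: "r \<ge> 1" and ram: "\<And>(V::nat set) E. finite V \<Longrightarrow> card V \<ge> r \<Longrightarrow>
      \<exists>A \<subseteq> V. card A = card (fst G) \<and> clique A E \<or> card A = card (fst H) \<and> indep A E"
    using ramsey2[of "card (fst G)" "card (fst H)"] by metis
  have "ramsey_arrows r G H"
    unfolding ramsey_arrows_def
  proof (intro allI impI)
    fix R :: "nat set set" assume "R \<subseteq> nsets {..<r} 2"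
    obtain A where A: "A \<subseteq> {..<r}"
      "card A = card (fst G) \<and> clique A R \<or> card A = card (fst H) \<and> indep A R"
      using ram[of "{..<r}" R] by auto
    have finA: "finite A" using A(1) finite_subset by blast
    from A(2) show "contains_copy ({..<r}, R) G
        \<or> contains_copy ({..<r}, nsets {..<r} 2 - R) H"
    proof
      assume c: "card A = card (fst G) \<and> clique A R"
      then have "nsets A 2 \<subseteq> R"
        by (auto simp: nsets_def card_2_iff clique_def)
      then show ?thesis
        using contains_copy_clique[OF assms(1), of A "({..<r}, R)"] A(1) finA c by simp
    next
      assume c: "card A = card (fst H) \<and> indep A R"
      then have "nsets A 2 \<subseteq> nsets {..<r} 2 - R"
        using A(1) by (auto simp: nsets_def card_2_iff indep_def)
      then show ?thesis
        using contains_copy_clique[OF assms(2), of A "({..<r}, nsets {..<r} 2 - R)"] A(1) finA c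
        by simp
    qed
  qed
  then have "0 < r \<and> ramsey_arrows r G H" using r by simp
  then show ?thesis
    unfolding ramsey_number_def by (rule LeastI)
qed

end

theory Submission
  imports Defs "HOL-Probability.Hoeffding" "HOL-Real_Asymp.Real_Asymp"
begin

text \<open>Fix a colouring of the edges of the complete graph on \<open>N\<close> vertices with no red \<open>B\<^bsub>\<alpha>n\<^esub>\<close> and no
blue \<open>B\<^sub>n\<close>, and put \<open>a = \<alpha>n/N\<close>, \<open>b = n/N\<close>. The two ends of a red edge have at most \<open>aN\<close> common
red neighbours, and the two ends of a blue edge at most \<open>bN\<close> common blue ones, up to bounded
errors. If \<open>N\<close> exceeds \<open>(3/2 + 3\<alpha> + \<epsilon>)n\<close>, then \<open>6a + 3b < 2\<close>, and also \<open>2b < 1\<close> because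
\<open>\<alpha> \<ge> 1/6\<close>, both by a fixed margin. The upper bound is the statement that no large colouring
satisfies all of this.

The basic device is to average over monochromatic cliques of a large constant size. For a set \<open>X\<close>
let \<open>w\<^sub>X(v)\<close> be the proportion of \<open>X\<close> that is joined to \<open>v\<close> in red. Averaging the codegree
conditions over pairs of vertices gives, up to \<open>O(N/|X|)\<close>, that \<open>\<Sum>w\<^sub>X\<^sup>2 \<le> aN\<close> for a red clique,
\<open>\<Sum>(1 - w\<^sub>X)\<^sup>2 \<le> bN\<close> for a blue clique, \<open>\<Sum>w\<^sub>X w\<^sub>Y \<le> aN\<close> if all edges between \<open>X\<close> and \<open>Y\<close>
are red, and \<open>\<Sum>(1 - w\<^sub>X)(1 - w\<^sub>Y) \<le> bN\<close> if they are blue. The fact that a sum of squares of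
linear combinations of such functions is not negative then turns into an inequality between \<open>a\<close>, \<open>b\<close>
and average degrees.
The decisive one is \<open>\<Sum>(w\<^sub>X + w\<^sub>Y + w\<^sub>Z - 1)\<^sup>2 \<ge> 0\<close> for three blue cliques with only red edges
between them: the degrees cancel, and \<open>6a + 3b \<ge> 2\<close> remains (\<open>no_red_tripartite\<close>).

It remains to handle colourings without this configuration. Split the vertices by their red degree
at a threshold slightly above \<open>(3a/2 + 1/6)N\<close>. Vertices of high degree contain no large red
clique, and those of low degree no large blue clique. A second square excludes two red cliques of
low degree with only blue edges between them, so that almost all edges inside \<open>Low\<close> are red. Among
the vertices of high degree there is, in the sense of cliques, no red triangle. If all vertices
had high degree, then two blue cliques joined in red would satisfy
\<open>(1 - w\<^sub>X)\<^sup>2 + (1 - w\<^sub>Y)\<^sup>2 \<ge> 1\<close> at almost every vertex, which gives \<open>2b \<ge> 1\<close>, a contradiction.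
In general the vertices of \<open>Low\<close> may violate this pointwise bound for the chosen pair, but not
for all pairs: their red degrees are so small that their average contribution over \<open>High\<close> exceeds
what is required. The contribution of \<open>Low\<close> is bounded below by a function \<open>gain\<close> of the vertices
of the clique, whose average over \<open>High\<close> is larger than a value \<open>pivot\<close>, while the two sides of a
red pair of blue cliques have gains that add up to less than \<open>2 * pivot\<close> (\<open>red_pair_gain\<close>). By a
matching argument (\<open>level_pairing\<close>) there is a level \<open>s\<close> such that more vertices have a gain above
\<open>pivot + s\<close> than below \<open>pivot - s\<close>. The former send almost no red edges to \<open>High\<close> outside the
latter, hence a blue clique \<open>X\<close> among them sends almost only blue edges to at least half of \<open>High\<close>.
Together with its gain this makes \<open>\<Sum>(1 - w\<^sub>X)\<^sup>2\<close> larger than \<open>bN\<close> (\<open>contradiction\<close>).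

The lower bound for \<open>\<alpha> = 1/6\<close> comes from two blue cliques of size \<open>n\<close> with red edges between them,
and the one for \<open>\<alpha> = 1/4\<close> from a random colouring with red density \<open>1/3\<close>, in which Hoeffding's
inequality keeps all red codegrees near \<open>N/9\<close> and all blue ones near \<open>4N/9\<close>.\<close>

section \<open>Monochromatic cliques in large vertex sets\<close>

text \<open>The relation \<open>K\<close> is the red adjacency, or its negation for blue cliques; the diagonal is left
out so that the negation of an irreflexive relation can be used as it stands.\<close>

definition homog :: "('a \<Rightarrow> 'a \<Rightarrow> bool) \<Rightarrow> 'a set \<Rightarrow> bool" where
  "homog K X \<longleftrightarrow> (\<forall>x\<in>X. \<forall>y\<in>X. x \<noteq> y \<longrightarrow> K x y)"

text \<open>This packages the conclusion of Ramsey's theorem for a set \<open>S\<close> in which cliques of the other colour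
are already excluded.\<close>

definition fills :: "('a \<Rightarrow> 'a \<Rightarrow> bool) \<Rightarrow> nat \<Rightarrow> nat \<Rightarrow> 'a set \<Rightarrow> bool" where
  "fills K T R S \<longleftrightarrow> (\<forall>Q\<subseteq>S. R \<le> card Q \<longrightarrow> (\<exists>X\<subseteq>Q. card X = T \<and> homog K X))"

lemma homog_subset: "homog K X \<Longrightarrow> Y \<subseteq> X \<Longrightarrow> homog K Y"
  by (auto simp: homog_def)

lemma fills_subset: "fills K T R S \<Longrightarrow> Q \<subseteq> S \<Longrightarrow> fills K T R Q"
  by (auto simp: fills_def)

text \<open>One bound serves all graphs on the given vertex type. The bound has to be chosen before the graph
because the size of the graph depends on it.\<close>

lemma ramsey_homog:
  "\<exists>R. \<forall>(E :: 'a \<Rightarrow> 'a \<Rightarrow> bool) Q. symp E \<and> finite Q \<and> R \<le> card Q \<longrightarrow>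
     (\<exists>X\<subseteq>Q. card X = T \<and> (homog E X \<or> homog (\<lambda>x y. \<not> E x y) X))"
proof -
  obtain R where ram: "\<And>(V::'a set) F. finite V \<Longrightarrow> card V \<ge> R \<Longrightarrow>
      \<exists>X \<subseteq> V. card X = T \<and> clique X F \<or> card X = T \<and> indep X F"
    using ramsey2[of T T] by metis
  have "\<exists>X\<subseteq>Q. card X = T \<and> (homog E X \<or> homog (\<lambda>x y. \<not> E x y) X)"
    if "symp E" "finite Q" "R \<le> card Q" for E :: "'a \<Rightarrow> 'a \<Rightarrow> bool" and Q
  proof -
    have pair: "{x, y} \<in> {{x, y} | x y. E x y} \<longleftrightarrow> E x y" for x y
      using sympD[OF \<open>symp E\<close>] by (simp add: doubleton_eq_iff) blast
    show ?thesis
      using ram[OF that(2,3), of "{{x, y} | x y. E x y}"]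
      unfolding clique_def indep_def homog_def pair by metis
  qed
  then show ?thesis by blast
qed

text \<open>The pigeonhole principle for the at most \<open>2 ^ card S\<close> neighbourhoods in \<open>S\<close>.\<close>

lemma common_trace:
  assumes "finite S" "finite Q" "2 ^ card S * R < card Q"
  shows "\<exists>D\<subseteq>S. R \<le> card {v \<in> Q. {x \<in> S. C x v} = D}"
proof (rule ccontr)
  assume "\<not> ?thesis"
  then have small: "card {v \<in> Q. {x \<in> S. C x v} = D} \<le> R" if "D \<subseteq> S" for D
    using that by (meson nat_le_linear)
  have "v \<in> (\<Union>D\<in>Pow S. {v \<in> Q. {x \<in> S. C x v} = D})" if "v \<in> Q" for v
    using that by (intro UN_I[of "{x \<in> S. C x v}"]) simp_all
  then have "Q = (\<Union>D\<in>Pow S. {v \<in> Q. {x \<in> S. C x v} = D})" by blast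
  then have "card Q \<le> (\<Sum>D\<in>Pow S. card {v \<in> Q. {x \<in> S. C x v} = D})"
    using card_UN_le[of "Pow S" "\<lambda>D. {v \<in> Q. {x \<in> S. C x v} = D}"] assms(1) by simp
  also have "\<dots> \<le> (\<Sum>D\<in>Pow S. R)"
    by (intro sum_mono small) simp
  also have "\<dots> = 2 ^ card S * R"
    using assms(1) by (simp add: card_Pow)
  finally show False using assms(3) by simp
qed

text \<open>A relation of positive density between two sets contains a complete bipartite piece whose two sides
are cliques of prescribed kinds. A clique \<open>X0\<close> of size \<open>M\<close> is
taken in \<open>P\<close>; by double counting, many vertices of \<open>Q\<close> are related to at least \<open>T\<close> elements of
\<open>X0\<close>; many of these have the same trace on \<open>X0\<close>, and they contain a clique of their own.\<close>

lemma homogeneous_pair: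
  fixes C :: "'a \<Rightarrow> 'a \<Rightarrow> bool" and \<kappa> n :: real
  assumes fin: "finite P" "finite Q" and n: "real (card Q) \<le> n" and \<kappa>: "0 < \<kappa>" and T: "0 < T"
    and R1: "R1 \<le> card P" and P: "fills K1 M R1 P" and Q: "fills K2 T R2 Q"
    and deg: "\<And>x. x \<in> P \<Longrightarrow> \<kappa> * n \<le> real (card {y \<in> Q. C x y})"
    and M: "2 * real T \<le> \<kappa> * real M" and large: "2 ^ M * real R2 < \<kappa> * n / 2"
  shows "\<exists>X Y. X \<subseteq> P \<and> Y \<subseteq> Q \<and> T \<le> card X \<and> card X \<le> M \<and> card Y = T \<and> homog K1 X \<and> homog K2 Y
           \<and> (\<forall>x\<in>X. \<forall>y\<in>Y. C x y)"
proof -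
  obtain X0 where X0: "X0 \<subseteq> P" "card X0 = M" "homog K1 X0"
    using P R1 unfolding fills_def by blast
  have finX0: "finite X0" using X0(1) fin(1) finite_subset by blast
  have M0: "real M > 0" using M T \<kappa> by (cases "M = 0") auto
  have n0: "n \<ge> 0" using n by linarith
  define Q1 where "Q1 = {y \<in> Q. T \<le> card {x \<in> X0. C x y}}"
  have finQ1: "finite Q1" using fin(2) by (simp add: Q1_def)
  have "real M * (\<kappa> * n) = (\<Sum>x\<in>X0. \<kappa> * n)" using X0(2) by simp
  also have "\<dots> \<le> (\<Sum>x\<in>X0. real (card {y \<in> Q. C x y}))"
    using X0(1) by (intro sum_mono deg) auto
  also have "\<dots> = real (\<Sum>x\<in>X0. card {y \<in> Q. C x y})" by simp
  also have "(\<Sum>x\<in>X0. card {y \<in> Q. C x y}) = (\<Sum>y\<in>Q. card {x \<in> X0. C x y})"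
    by (rule sum_multicount_gen[OF finX0 fin(2)]) simp
  also have "real \<dots> = (\<Sum>y\<in>Q. real (card {x \<in> X0. C x y}))" by simp
  also have "\<dots> \<le> (\<Sum>y\<in>Q. real T + (if y \<in> Q1 then real M else 0))"
  proof (intro sum_mono)
    fix y assume y: "y \<in> Q"
    have "card {x \<in> X0. C x y} \<le> M"
      using card_mono[OF finX0, of "{x \<in> X0. C x y}"] X0(2) by auto
    then show "real (card {x \<in> X0. C x y}) \<le> real T + (if y \<in> Q1 then real M else 0)"
      using y by (auto simp: Q1_def)
  qed
  also have "\<dots> = real (card Q) * real T + real (card Q1) * real M"
  proof -
    have "Q \<inter> Q1 = Q1" by (auto simp: Q1_def)
    then show ?thesis
      using fin(2) by (simp add: sum.distrib flip: sum.inter_restrict)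
  qed
  also have "\<dots> \<le> n * (\<kappa> * real M / 2) + real (card Q1) * real M"
    using mult_mono[OF n, of "real T" "\<kappa> * real M / 2"] M n0 by simp
  finally have "real M * (\<kappa> * n / 2) \<le> real M * real (card Q1)"
    by (simp add: algebra_simps)
  then have "\<kappa> * n / 2 \<le> real (card Q1)" using M0 by simp
  then have "real (2 ^ M * R2) < real (card Q1)" using large by simp
  then have "2 ^ card X0 * R2 < card Q1"
    unfolding X0(2) of_nat_less_iff .
  then obtain X where X: "X \<subseteq> X0" "R2 \<le> card {v \<in> Q1. {x \<in> X0. C x v} = X}"
    using common_trace[OF finX0 finQ1] by blast
  have "{v \<in> Q1. {x \<in> X0. C x v} = X} \<subseteq> Q" by (auto simp: Q1_def)
  then obtain Y where Y: "Y \<subseteq> {v \<in> Q1. {x \<in> X0. C x v} = X}" "card Y = T" "homog K2 Y"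
    using Q X(2) unfolding fills_def by meson
  obtain y where y: "y \<in> Y" using Y(2) T by fastforce
  have "T \<le> card X" using y Y(1) by (auto simp: Q1_def)
  moreover have "card X \<le> M" using card_mono[OF finX0 X(1)] X0(2) by simp
  moreover have "\<forall>x\<in>X. \<forall>y\<in>Y. C x y" using Y(1) by auto
  moreover have "Y \<subseteq> Q" using Y(1) by (auto simp: Q1_def)
  moreover have "X \<subseteq> P" using X(1) X0(1) by simp
  moreover have "homog K1 X" using X0(3) X(1) homog_subset by blast
  ultimately show ?thesis using Y(2,3) by blast
qed

section \<open>Level sets of a function with positive sum\<close>

text \<open>The hypothesis on level sets allows all but \<open>k\<close> of the positive values to be matched with negative
values of at least the same modulus, and each of the remaining \<open>k\<close> values is at most \<open>U\<close>.
The induction removes the largest value, together with a partner if one exists.\<close>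

lemma level_pairing:
  fixes u :: "'a \<Rightarrow> real"
  assumes "finite H" and "0 \<le> U" and "\<And>x. x \<in> H \<Longrightarrow> u x \<le> U"
    and "\<And>s. 0 \<le> s \<Longrightarrow> card {x \<in> H. s < u x} \<le> card {x \<in> H. u x < - s} + k"
  shows "sum u H \<le> real k * U"
  using assms
proof (induction "card H" arbitrary: H k rule: less_induct)
  case (less H k)
  show ?case
  proof (cases "\<exists>x\<in>H. 0 < u x")
    case False
    then have "sum u H \<le> 0" by (intro sum_nonpos) force
    also have "0 \<le> real k * U" using less.prems(2) by simp
    finally show ?thesis .
  next
    case True
    have ne: "H \<noteq> {}" using True by auto
    obtain x where x: "x \<in> H" "\<And>y. y \<in> H \<Longrightarrow> u y \<le> u x"
    proof -
      have "Max (u ` H) \<in> u ` H" using less.prems(1) ne by simp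
      then obtain x where "x \<in> H" "u x = Max (u ` H)" by (metis imageE)
      moreover have "u y \<le> Max (u ` H)" if "y \<in> H" for y using that less.prems(1) by simp
      ultimately show ?thesis using that by metis
    qed
    have ux: "0 < u x" using True x(2) by force
    define H1 where "H1 = H - {x}"
    have finH1: "finite H1" and cardH1: "card H1 < card H"
      using less.prems(1) card_Diff1_less[OF less.prems(1) x(1)] by (simp_all add: H1_def)
    have sumH1: "sum u H = u x + sum u H1"
      unfolding H1_def using less.prems(1) x(1) by (simp add: sum.remove)
    have up: "card {y \<in> H. s < u y} = Suc (card {y \<in> H1. s < u y})" if "s < u x" for s
    proof -
      have "{y \<in> H. s < u y} = insert x {y \<in> H1. s < u y}" using that x(1) by (auto simp: H1_def)
      then show ?thesis using finH1 by (simp add: H1_def)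
    qed
    have top: "{y \<in> H. s < u y} = {}" if "u x \<le> s" for s
      using x(2) that by force
    have down: "{y \<in> H. u y < - s} = {y \<in> H1. u y < - s}" if "0 \<le> s" for s
      using that ux by (auto simp: H1_def)
    show ?thesis
    proof (cases "\<exists>y\<in>H. u y \<le> - u x")
      case True
      then obtain y where y: "y \<in> H1" "u y \<le> - u x" using ux by (force simp: H1_def)
      define H2 where "H2 = H1 - {y}"
      have finH2: "finite H2" and cardH2: "card H2 < card H"
        using finH1 cardH1 card_Diff1_less[OF finH1 y(1)] by (simp_all add: H2_def)
      have "sum u H2 \<le> real k * U"
      proof (rule less.hyps[OF cardH2 finH2 less.prems(2)])
        show "u z \<le> U" if "z \<in> H2" for z using that less.prems(3) by (auto simp: H1_def H2_def)
        fix s :: real assume s: "0 \<le> s"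
        show "card {x \<in> H2. s < u x} \<le> card {x \<in> H2. u x < - s} + k"
        proof (cases "s < u x")
          case True
          have "{z \<in> H1. s < u z} = {z \<in> H2. s < u z}"
            using y s ux by (auto simp: H2_def)
          moreover have "{z \<in> H1. u z < - s} = insert y {z \<in> H2. u z < - s}"
            using y True by (auto simp: H2_def)
          then have "card {z \<in> H1. u z < - s} = Suc (card {z \<in> H2. u z < - s})"
            using finH2 by (simp add: H2_def)
          ultimately show ?thesis using less.prems(4)[OF s] up[OF True] down[OF s] by simp
        next
          case False
          then have "{x \<in> H2. s < u x} = {}" using top[of s] by (auto simp: H1_def H2_def)
          then show ?thesis by (simp only: card.empty le0)
        qed
      qed
      moreover have "sum u H1 = u y + sum u H2"
        unfolding H2_def using finH1 y(1) by (simp add: sum.remove)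
      ultimately show ?thesis using sumH1 y(2) by simp
    next
      case no: False
      (* No value lies below -u x, so at the level s0 the lower set is empty while x is in the
         upper one; hence k > 0, and x is one of the k exceptions. *)
      define s0 where "s0 = (if H = {} then 0 else max 0 (- Min (u ` H)))"
      have Min: "Min (u ` H) \<le> u y" if "y \<in> H" for y using that less.prems(1) by simp
      have "Min (u ` H) \<in> u ` H" using less.prems(1) ne by simp
      then have s0: "0 \<le> s0" "s0 < u x" using no ux ne by (auto simp: s0_def)
      have "{y \<in> H. u y < - s0} = {}"
        using Min ne by (force simp: s0_def)
      then have "card {y \<in> H. u y < - s0} = 0" by (simp only: card.empty)
      then have "1 \<le> k" using less.prems(4)[OF s0(1)] up[OF s0(2)] by simp
      have "sum u H1 \<le> real (k - 1) * U"
      proof (rule less.hyps[OF cardH1 finH1 less.prems(2)])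
        show "u z \<le> U" if "z \<in> H1" for z using that less.prems(3) by (auto simp: H1_def)
        fix s :: real assume s: "0 \<le> s"
        show "card {x \<in> H1. s < u x} \<le> card {x \<in> H1. u x < - s} + (k - 1)"
        proof (cases "s < u x")
          case True
          then show ?thesis using less.prems(4)[OF s] up[OF True] down[OF s] \<open>1 \<le> k\<close> by simp
        next
          case False
          then have "{x \<in> H1. s < u x} = {}" using top[of s] by (auto simp: H1_def)
          then show ?thesis by (simp only: card.empty le0)
        qed
      qed
      then show ?thesis
        using sumH1 less.prems(3)[OF x(1)] \<open>1 \<le> k\<close> by (simp add: of_nat_diff algebra_simps)
    qed
  qed
qed

section \<open>Averages over finite sets\<close>

definition avg :: "'a set \<Rightarrow> ('a \<Rightarrow> real) \<Rightarrow> real" where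
  "avg X f = (\<Sum>x\<in>X. f x) / real (card X)"

lemma avg_mono: "(\<And>x. x \<in> X \<Longrightarrow> f x \<le> g x) \<Longrightarrow> avg X f \<le> avg X g"
  unfolding avg_def by (intro divide_right_mono sum_mono) auto

lemma avg_const: "0 < card X \<Longrightarrow> avg X (\<lambda>_. c) = c"
  by (simp add: avg_def)

lemma avg_le: "0 < card X \<Longrightarrow> (\<And>x. x \<in> X \<Longrightarrow> f x \<le> c) \<Longrightarrow> avg X f \<le> c"
  using avg_mono[of X f "\<lambda>_. c"] avg_const[of X c] by simp

lemma avg_ge: "0 < card X \<Longrightarrow> (\<And>x. x \<in> X \<Longrightarrow> c \<le> f x) \<Longrightarrow> c \<le> avg X f"
  using avg_mono[of X "\<lambda>_. c" f] avg_const[of X c] by simp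

lemma avg_diff: "avg X (\<lambda>x. f x - g x) = avg X f - avg X g"
  by (simp add: avg_def sum_subtractf diff_divide_distrib)

lemma avg_mult: "avg X (\<lambda>x. c * f x) = c * avg X f"
  by (simp add: avg_def sum_distrib_left)

lemma avg_sum: "(\<Sum>v\<in>S. avg X (\<lambda>x. \<phi> x v)) = avg X (\<lambda>x. \<Sum>v\<in>S. \<phi> x v)"
  unfolding avg_def by (simp add: sum.swap[of _ X S] flip: sum_divide_distrib)

lemma sum_avg_mult:
  "(\<Sum>v\<in>V. avg X (\<lambda>x. \<phi> x v) * avg Y (\<lambda>y. \<psi> y v)) = avg X (\<lambda>x. avg Y (\<lambda>y. \<Sum>v\<in>V. \<phi> x v * \<psi> y v))"
proof -
  have "avg X (\<lambda>x. \<phi> x v) * avg Y (\<lambda>y. \<psi> y v) = avg X (\<lambda>x. avg Y (\<lambda>y. \<phi> x v * \<psi> y v))" for v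
    unfolding avg_mult by (simp add: avg_def sum_distrib_right sum_divide_distrib)
  then show ?thesis by (simp add: avg_sum)
qed

lemma sum_avg_mult_le:
  assumes "0 < card X" "0 < card Y"
    and "\<And>x y. x \<in> X \<Longrightarrow> y \<in> Y \<Longrightarrow> (\<Sum>v\<in>V. \<phi> x v * \<psi> y v) \<le> K"
  shows "(\<Sum>v\<in>V. avg X (\<lambda>x. \<phi> x v) * avg Y (\<lambda>y. \<psi> y v)) \<le> K"
  unfolding sum_avg_mult using assms by (intro avg_le) auto

text \<open>The diagonal terms of the double average are a proportion \<open>1 / card X\<close> of all terms, so they cost
only \<open>n / card X\<close>.\<close>

lemma sum_avg_square_le:
  assumes X: "0 < card X" and K: "0 \<le> K"
    and off: "\<And>x y. x \<in> X \<Longrightarrow> y \<in> X \<Longrightarrow> x \<noteq> y \<Longrightarrow> (\<Sum>v\<in>V. \<phi> x v * \<phi> y v) \<le> K"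
    and diag: "\<And>x. x \<in> X \<Longrightarrow> (\<Sum>v\<in>V. \<phi> x v * \<phi> x v) \<le> n"
  shows "(\<Sum>v\<in>V. (avg X (\<lambda>x. \<phi> x v))\<^sup>2) \<le> K + n / real (card X)"
proof -
  have fin: "finite X" using X card_ge_0_finite by blast
  have "avg X (\<lambda>y. \<Sum>v\<in>V. \<phi> x v * \<phi> y v) \<le> K + n / real (card X)" if x: "x \<in> X" for x
  proof -
    have "(\<Sum>y\<in>X. \<Sum>v\<in>V. \<phi> x v * \<phi> y v) \<le> (\<Sum>y\<in>X. K + (if y = x then n else 0))"
    proof (intro sum_mono)
      fix y assume "y \<in> X"
      then show "(\<Sum>v\<in>V. \<phi> x v * \<phi> y v) \<le> K + (if y = x then n else 0)"
        using off[OF x] diag[OF x] K by (cases "y = x") auto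
    qed
    also have "\<dots> = real (card X) * K + n"
      using fin x by (simp add: sum.distrib)
    finally show ?thesis
      using X by (simp add: avg_def field_simps)
  qed
  then show ?thesis
    unfolding power2_eq_square sum_avg_mult by (rule avg_le[OF X])
qed

section \<open>Codegree conditions averaged over cliques\<close>

text \<open>The relation \<open>E\<close> is the red adjacency. A blue pair \<open>x\<close>, \<open>y\<close> is itself counted among the common
non-neighbours of \<open>x\<close> and \<open>y\<close>, which lets sums run over all of \<open>V\<close>.\<close>

locale codegree_bounded =
  fixes V :: "'a set" and E :: "'a \<Rightarrow> 'a \<Rightarrow> bool" and A B :: real
  assumes finite_V: "finite V"
    and symp_E: "symp E"
    and irrefl: "\<not> E x x"
    and red_codegree: "x \<in> V \<Longrightarrow> y \<in> V \<Longrightarrow> E x y \<Longrightarrow> real (card {v \<in> V. E x v \<and> E y v}) \<le> A"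
    and blue_codegree: "x \<in> V \<Longrightarrow> y \<in> V \<Longrightarrow> x \<noteq> y \<Longrightarrow> \<not> E x y \<Longrightarrow>
                          real (card {v \<in> V. \<not> E x v \<and> \<not> E y v}) \<le> B"
    and A_nonneg: "0 \<le> A" and B_nonneg: "0 \<le> B"
begin

abbreviation N :: real where "N \<equiv> real (card V)"

abbreviation blue :: "'a \<Rightarrow> 'a \<Rightarrow> bool" where "blue \<equiv> \<lambda>x y. \<not> E x y"

definition deg :: "'a \<Rightarrow> real" where "deg x = real (card {v \<in> V. E x v})"

definition red_share :: "'a set \<Rightarrow> 'a \<Rightarrow> real" where "red_share X v = avg X (\<lambda>x. of_bool (E x v))"

lemma E_commute: "E x y \<longleftrightarrow> E y x"
  using symp_E by (auto dest: sympD)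

lemma one_minus_red_share: "0 < card X \<Longrightarrow> 1 - red_share X v = avg X (\<lambda>x. of_bool (\<not> E x v))"
proof -
  assume X: "0 < card X"
  have "avg X (\<lambda>x. of_bool (\<not> E x v)) = avg X (\<lambda>x. 1 - of_bool (E x v))"
    by (rule arg_cong[of _ _ "avg X"]) auto
  then show ?thesis using X by (simp add: avg_diff avg_const red_share_def)
qed

lemma sum_red_share: "Q \<subseteq> V \<Longrightarrow> (\<Sum>v\<in>Q. red_share X v) = avg X (\<lambda>x. real (card {v \<in> Q. E x v}))"
  unfolding red_share_def avg_sum using finite_subset[OF _ finite_V]
  by (auto intro!: arg_cong[of _ _ "avg X"] simp: Int_def)

lemma sum_red_share_deg: "(\<Sum>v\<in>V. red_share X v) = avg X deg"
  using sum_red_share[of V X] by (simp add: deg_def[abs_def])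

lemma red_cross:
  assumes "X \<subseteq> V" "Y \<subseteq> V" "0 < card X" "0 < card Y" "\<forall>x\<in>X. \<forall>y\<in>Y. E x y"
  shows "(\<Sum>v\<in>V. red_share X v * red_share Y v) \<le> A"
  unfolding red_share_def
proof (intro sum_avg_mult_le assms(3,4))
  fix x y assume xy: "x \<in> X" "y \<in> Y"
  have "(\<Sum>v\<in>V. of_bool (E x v) * of_bool (E y v)) = real (card {v \<in> V. E x v \<and> E y v})"
    using finite_V by (simp add: Int_def flip: of_bool_conj)
  then show "(\<Sum>v\<in>V. of_bool (E x v) * of_bool (E y v)) \<le> A"
    using red_codegree[of x y] xy assms by auto
qed

lemma blue_cross:
  assumes "X \<subseteq> V" "Y \<subseteq> V" "0 < card X" "0 < card Y" "\<forall>x\<in>X. \<forall>y\<in>Y. x \<noteq> y \<and> \<not> E x y"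
  shows "(\<Sum>v\<in>V. (1 - red_share X v) * (1 - red_share Y v)) \<le> B"
  unfolding one_minus_red_share[OF assms(3)] one_minus_red_share[OF assms(4)]
proof (intro sum_avg_mult_le assms(3,4))
  fix x y assume xy: "x \<in> X" "y \<in> Y"
  have "(\<Sum>v\<in>V. of_bool (\<not> E x v) * of_bool (\<not> E y v)) = real (card {v \<in> V. \<not> E x v \<and> \<not> E y v})"
    using finite_V by (simp add: Int_def flip: of_bool_conj)
  then show "(\<Sum>v\<in>V. of_bool (\<not> E x v) * of_bool (\<not> E y v)) \<le> B"
    using blue_codegree[of x y] xy assms by auto
qed

lemma red_clique:
  assumes "X \<subseteq> V" "0 < card X" "homog E X"
  shows "(\<Sum>v\<in>V. (red_share X v)\<^sup>2) \<le> A + N / real (card X)"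
  unfolding red_share_def
proof (intro sum_avg_square_le assms(2) A_nonneg)
  fix x y assume xy: "x \<in> X" "y \<in> X" "x \<noteq> y"
  have "(\<Sum>v\<in>V. of_bool (E x v) * of_bool (E y v)) = real (card {v \<in> V. E x v \<and> E y v})"
    using finite_V by (simp add: Int_def flip: of_bool_conj)
  then show "(\<Sum>v\<in>V. of_bool (E x v) * of_bool (E y v)) \<le> A"
    using red_codegree[of x y] xy assms by (auto simp: homog_def)
next
  fix x
  have "(\<Sum>v\<in>V. of_bool (E x v) * of_bool (E x v)) \<le> (\<Sum>v\<in>V. 1 :: real)"
    by (intro sum_mono) auto
  then show "(\<Sum>v\<in>V. of_bool (E x v) * of_bool (E x v)) \<le> N" by simp
qed

lemma blue_clique:
  assumes "X \<subseteq> V" "0 < card X" "homog blue X"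
  shows "(\<Sum>v\<in>V. (1 - red_share X v)\<^sup>2) \<le> B + N / real (card X)"
  unfolding one_minus_red_share[OF assms(2)]
proof (intro sum_avg_square_le assms(2) B_nonneg)
  fix x y assume xy: "x \<in> X" "y \<in> X" "x \<noteq> y"
  have "(\<Sum>v\<in>V. of_bool (\<not> E x v) * of_bool (\<not> E y v)) = real (card {v \<in> V. \<not> E x v \<and> \<not> E y v})"
    using finite_V by (simp add: Int_def flip: of_bool_conj)
  then show "(\<Sum>v\<in>V. of_bool (\<not> E x v) * of_bool (\<not> E y v)) \<le> B"
    using blue_codegree[of x y] xy assms by (auto simp: homog_def)
next
  fix x
  have "(\<Sum>v\<in>V. of_bool (\<not> E x v) * of_bool (\<not> E x v)) \<le> (\<Sum>v\<in>V. 1 :: real)"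
    by (intro sum_mono) auto
  then show "(\<Sum>v\<in>V. of_bool (\<not> E x v) * of_bool (\<not> E x v)) \<le> N" by simp
qed

end

section \<open>Excluded configurations of cliques\<close>

text \<open>With \<open>a = A/N\<close> and \<open>b = B/N\<close>, the conditions are \<open>6a + 3b < 2\<close> and \<open>2b < 1\<close> with the margin
\<open>3200\<eta>\<close>; all error terms below are small multiples of \<open>\<eta>\<close>. Cliques of size \<open>T\<close> have a
diagonal contribution of at most \<open>\<eta> N\<close>.\<close>

locale supercritical = codegree_bounded +
  fixes \<eta> :: real and T :: nat
  assumes \<eta>: "0 < \<eta>"
    and V_nonempty: "0 < card V"
    and weight: "6 * A + 3 * B + 3200 * (\<eta> * N) \<le> 2 * N"
    and half: "2 * B + 3200 * (\<eta> * N) \<le> N"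
    and T: "1 \<le> \<eta> * real T"
begin

text \<open>Up to the diagonal error, a red clique has average degree at most \<open>3A/2 + N/6\<close> and a blue one at least
\<open>2N/3 - 3B/4\<close>. These bounds differ by at least \<open>800\<eta> N\<close>, and the threshold lies between them.\<close>

definition threshold :: real where "threshold = 3 / 2 * A + N / 6 + 200 * (\<eta> * N)"

definition High :: "'a set" where "High = {x \<in> V. threshold < deg x}"

definition Low :: "'a set" where "Low = {x \<in> V. deg x \<le> threshold}"

lemma N_pos: "0 < N" using V_nonempty by simp

lemma err_pos: "0 < \<eta> * N" using \<eta> N_pos by simp

lemma T_pos: "0 < T" using T by (cases "T = 0") auto

lemma finite_High: "finite High" and finite_Low: "finite Low"
  using finite_V by (simp_all add: High_def Low_def)

lemma High_sub: "High \<subseteq> V" and Low_sub: "Low \<subseteq> V"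
  by (auto simp: High_def Low_def)

lemma V_split: "V = High \<union> Low" "High \<inter> Low = {}"
  by (auto simp: High_def Low_def)

lemma error_le:
  assumes "T \<le> t"
  shows "N / real t \<le> \<eta> * N"
proof -
  have "\<eta> * real T \<le> \<eta> * real t" using assms \<eta> by simp
  then have "1 \<le> \<eta> * real t" using T by linarith
  then have "1 * N \<le> \<eta> * real t * N" using N_pos by (intro mult_right_mono) auto
  moreover have "0 < real t" using assms T_pos by simp
  ultimately show ?thesis by (simp add: field_simps)
qed

lemma red_clique_le:
  assumes "X \<subseteq> V" "T \<le> card X" "homog E X"
  shows "(\<Sum>v\<in>V. (red_share X v)\<^sup>2) \<le> A + \<eta> * N"
  using red_clique[of X] error_le[OF assms(2)] assms T_pos by fastforce

lemma blue_clique_le: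
  assumes "X \<subseteq> V" "T \<le> card X" "homog blue X"
  shows "(\<Sum>v\<in>V. (1 - red_share X v)\<^sup>2) \<le> B + \<eta> * N"
  using blue_clique[of X] error_le[OF assms(2)] assms T_pos by fastforce

text \<open>The coefficient 3 in the square comes from the extremal density: in a random colouring with red
density \<open>1/3\<close> all the values \<open>w\<^sub>X(v)\<close> are close to \<open>1/3\<close>.\<close>

lemma avg_deg_red_clique:
  assumes "X \<subseteq> V" "T \<le> card X" "homog E X"
  shows "avg X deg < threshold"
proof -
  have "0 \<le> (\<Sum>v\<in>V. (3 * red_share X v - 1)\<^sup>2)" by (simp add: sum_nonneg)
  also have "\<dots> = 9 * (\<Sum>v\<in>V. (red_share X v)\<^sup>2) - 6 * avg X deg + N"
    by (simp add: power2_diff power_mult_distrib sum.distrib sum_subtractf flip: sum_red_share_deg sum_distrib_left)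
  finally show ?thesis
    using red_clique_le[OF assms] err_pos unfolding threshold_def by linarith
qed

text \<open>The tangent at \<open>x = 1/3\<close>.\<close>

lemma square_ge_tangent: "8 / 9 - 4 / 3 * x \<le> (1 - x)\<^sup>2" for x :: real
proof -
  have "(1 - x)\<^sup>2 - (8 / 9 - 4 / 3 * x) = (x - 1 / 3)\<^sup>2"
    by (simp add: power2_eq_square algebra_simps)
  then show ?thesis by (smt (verit) zero_le_power2)
qed

lemma B_le_tangent: "B + 800 * (\<eta> * N) \<le> 8 / 9 * N - 4 / 3 * threshold"
proof -
  have "4 / 3 * threshold = 2 * A + 2 / 9 * N + 800 / 3 * (\<eta> * N)" by (simp add: threshold_def)
  then show ?thesis using weight by linarith
qed

lemma avg_deg_blue_clique:
  assumes "X \<subseteq> V" "T \<le> card X" "homog blue X"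
  shows "threshold < avg X deg"
proof -
  have "8 / 9 * N - 4 / 3 * avg X deg = (\<Sum>v\<in>V. 8 / 9 - 4 / 3 * red_share X v)"
    unfolding sum_subtractf sum_distrib_left[symmetric] sum_red_share_deg by simp
  also have "\<dots> \<le> (\<Sum>v\<in>V. (1 - red_share X v)\<^sup>2)" by (intro sum_mono square_ge_tangent)
  finally show ?thesis
    using blue_clique_le[OF assms] B_le_tangent err_pos by linarith
qed

lemma no_red_clique_High:
  assumes "X \<subseteq> High" "T \<le> card X" "homog E X" shows False
proof -
  have X: "0 < card X" using assms(2) T_pos by simp
  have "threshold \<le> avg X deg" using assms(1) X by (intro avg_ge) (auto simp: High_def)
  then show False
    using avg_deg_red_clique[of X] assms High_sub by fastforce
qed

lemma no_blue_clique_Low: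
  assumes "X \<subseteq> Low" "T \<le> card X" "homog blue X" shows False
proof -
  have X: "0 < card X" using assms(2) T_pos by simp
  have "avg X deg \<le> threshold" using assms(1) X by (intro avg_le) (auto simp: Low_def)
  then show False
    using avg_deg_blue_clique[of X] assms Low_sub by fastforce
qed

text \<open>Expanding the square \<open>(w\<^sub>X + w\<^sub>Y + w\<^sub>Z - 1)\<^sup>2\<close> in terms of \<open>(1 - w\<^sub>X)\<^sup>2\<close> and the mixed products
leaves no linear term, so the bound involves no degrees. This is where the constant
\<open>3/2 + 3\<alpha>\<close> comes from.\<close>

lemma no_red_tripartite:
  assumes sub: "X \<subseteq> V" "Y \<subseteq> V" "Z \<subseteq> V"
    and card: "T \<le> card X" "T \<le> card Y" "T \<le> card Z"
    and blue: "homog blue X" "homog blue Y" "homog blue Z"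
    and red: "\<forall>x\<in>X. \<forall>y\<in>Y. E x y" "\<forall>x\<in>X. \<forall>z\<in>Z. E x z" "\<forall>y\<in>Y. \<forall>z\<in>Z. E y z"
  shows False
proof -
  have pos: "0 < card X" "0 < card Y" "0 < card Z" using card T_pos by auto
  have "0 \<le> (\<Sum>v\<in>V. (red_share X v + red_share Y v + red_share Z v - 1)\<^sup>2)" by (simp add: sum_nonneg)
  also have "\<dots> = (\<Sum>v\<in>V. (1 - red_share X v)\<^sup>2) + (\<Sum>v\<in>V. (1 - red_share Y v)\<^sup>2) + (\<Sum>v\<in>V. (1 - red_share Z v)\<^sup>2)
      + 2 * (\<Sum>v\<in>V. red_share X v * red_share Y v) + 2 * (\<Sum>v\<in>V. red_share X v * red_share Z v)
      + 2 * (\<Sum>v\<in>V. red_share Y v * red_share Z v) - 2 * N"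
  proof -
    have "(red_share X v + red_share Y v + red_share Z v - 1)\<^sup>2
       = (1 - red_share X v)\<^sup>2 + (1 - red_share Y v)\<^sup>2 + (1 - red_share Z v)\<^sup>2
       + 2 * (red_share X v * red_share Y v) + 2 * (red_share X v * red_share Z v) + 2 * (red_share Y v * red_share Z v) - 2" for v
      by (simp add: power2_eq_square algebra_simps)
    then show ?thesis by (simp add: sum.distrib sum_subtractf sum_distrib_left)
  qed
  finally show False
    using blue_clique_le[OF sub(1) card(1) blue(1)] blue_clique_le[OF sub(2) card(2) blue(2)]
      blue_clique_le[OF sub(3) card(3) blue(3)]
      red_cross[OF sub(1,2) pos(1,2) red(1)] red_cross[OF sub(1,3) pos(1,3) red(2)]
      red_cross[OF sub(2,3) pos(2,3) red(3)] weight err_pos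
    by linarith
qed

text \<open>For a blue pair the mixed product contributes the degrees with a positive sign, so that here the upper
bound on degrees in \<open>Low\<close> is what makes the sum of squares negative. The square is four times that of
\<open>3/2 w\<^sub>X + 3/2 w\<^sub>Y - 1\<close>, whose weights have the same total as in \<open>no_red_tripartite\<close>.\<close>

lemma no_blue_bipartite_Low:
  assumes sub: "X \<subseteq> Low" "Y \<subseteq> Low" and card: "T \<le> card X" "T \<le> card Y"
    and red: "homog E X" "homog E Y" and blue: "\<forall>x\<in>X. \<forall>y\<in>Y. x \<noteq> y \<and> \<not> E x y"
  shows False
proof -
  have pos: "0 < card X" "0 < card Y" using card T_pos by auto
  have subV: "X \<subseteq> V" "Y \<subseteq> V" using sub Low_sub by auto
  have deg: "avg X deg \<le> threshold" "avg Y deg \<le> threshold"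
    using sub pos by (auto intro!: avg_le simp: Low_def)
  have "0 \<le> (\<Sum>v\<in>V. (3 * red_share X v + 3 * red_share Y v - 2)\<^sup>2)" by (simp add: sum_nonneg)
  also have "\<dots> = 9 * (\<Sum>v\<in>V. (red_share X v)\<^sup>2) + 9 * (\<Sum>v\<in>V. (red_share Y v)\<^sup>2)
      + 18 * (\<Sum>v\<in>V. (1 - red_share X v) * (1 - red_share Y v)) + 6 * avg X deg + 6 * avg Y deg - 14 * N"
  proof -
    have "(3 * red_share X v + 3 * red_share Y v - 2)\<^sup>2 = 9 * (red_share X v)\<^sup>2 + 9 * (red_share Y v)\<^sup>2
        + 18 * ((1 - red_share X v) * (1 - red_share Y v)) + 6 * red_share X v + 6 * red_share Y v - 14" for v
      by (simp add: power2_eq_square algebra_simps)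
    then show ?thesis by (simp add: sum.distrib sum_subtractf sum_distrib_left flip: sum_red_share_deg)
  qed
  finally show False
    using red_clique_le[OF subV(1) card(1) red(1)] red_clique_le[OF subV(2) card(2) red(2)]
      blue_cross[OF subV pos blue] deg weight err_pos
    unfolding threshold_def by linarith
qed

end

section \<open>Vertices of low and of high red degree\<close>

text \<open>The function \<open>ram\<close> gives Ramsey bounds. The sizes \<open>T\<close>, \<open>T1\<close>, \<open>M\<close>, \<open>M1\<close> form a hierarchy: from a
clique of size \<open>T1\<close>, a vertex with red share at least \<open>\<eta>\<close> still leaves a subclique of size \<open>T\<close>,
and \<open>M\<close>, \<open>M1\<close> are the sizes of the auxiliary cliques in \<open>homogeneous_pair\<close> that lead to sides of
size \<open>T\<close> and \<open>T1\<close>.\<close>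

locale supercritical_ramsey = supercritical +
  fixes ram :: "nat \<Rightarrow> nat" and T1 M M1 :: nat
  assumes ramsey: "Q \<subseteq> V \<Longrightarrow> ram t \<le> card Q \<Longrightarrow> \<exists>X\<subseteq>Q. card X = t \<and> (homog E X \<or> homog blue X)"
    and T1: "real T \<le> \<eta> * real T1"
    and M: "2 * real T \<le> \<eta> * real M"
    and M1: "2 * real T1 \<le> \<eta> * real M1"
    and large: "2 ^ M * real (ram T) < \<eta> * N / 2" "2 ^ M1 * real (ram T1) < \<eta> * N / 2"
      "2 ^ (M1 + T1) * real (ram T) < \<eta> * N" "real (ram M) + 1 \<le> \<eta> * N"
      "real (ram M1) + real (ram T) + 1 \<le> \<eta> * N"
begin

abbreviation h :: real where "h \<equiv> real (card High)"

abbreviation l :: real where "l \<equiv> real (card Low)"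

definition deg_Low :: "'a \<Rightarrow> real" where "deg_Low x = real (card {y \<in> Low. E x y})"

lemma h_plus_l: "h + l = N"
  using V_split card_Un_disjoint[OF finite_High finite_Low] by simp

lemma sum_split: "(\<Sum>v\<in>V. f v) = (\<Sum>v\<in>High. f v) + (\<Sum>v\<in>Low. f v)" for f :: "'a \<Rightarrow> real"
  using sum.union_disjoint[OF finite_High finite_Low V_split(2), of f] V_split(1) by simp

lemma eta_small: "3200 * \<eta> \<le> 1"
proof -
  have "3200 * \<eta> * N \<le> 1 * N" using half B_nonneg by linarith
  then show ?thesis using N_pos by simp
qed

lemma T_le_T1: "T \<le> T1"
proof -
  have "\<eta> * real T1 \<le> 1 * real T1" using eta_small \<eta> by (intro mult_right_mono) auto
  then show ?thesis using T1 by simp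
qed

lemma fills_High: "T \<le> t \<Longrightarrow> fills blue t (ram t) High"
  unfolding fills_def using ramsey[of _ t] no_red_clique_High High_sub by (metis order_trans)

lemma fills_Low: "T \<le> t \<Longrightarrow> fills E t (ram t) Low"
  unfolding fills_def using ramsey[of _ t] no_blue_clique_Low Low_sub by (metis order_trans)

lemma card_le_N: "Q \<subseteq> V \<Longrightarrow> real (card Q) \<le> N"
  using card_mono[OF finite_V] by simp

lemma T_le_M: "T \<le> M"
proof -
  have "\<eta> * real M \<le> 1 * real M" using eta_small \<eta> by (intro mult_right_mono) auto
  then show ?thesis using M by simp
qed

lemma T1_le_M1: "T1 \<le> M1"
proof -
  have "\<eta> * real M1 \<le> 1 * real M1" using eta_small \<eta> by (intro mult_right_mono) auto
  then show ?thesis using M1 by simp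
qed

text \<open>Almost all pairs inside \<open>Low\<close> are red: if many vertices of \<open>Low\<close> had many blue neighbours in \<open>Low\<close>,
then there would be two red cliques in \<open>Low\<close> joined completely in blue.\<close>

lemma sum_deg_Low_in_Low: "l * l - 2 * (\<eta> * N) * N \<le> (\<Sum>z\<in>Low. deg_Low z)"
proof -
  define P where "P = {z \<in> Low. \<eta> * N \<le> real (card {y \<in> Low. z \<noteq> y \<and> \<not> E z y})}"
  have finP: "finite P" and PL: "P \<subseteq> Low" using finite_Low by (auto simp: P_def)
  have "card P < ram M"
  proof (rule ccontr)
    assume "\<not> card P < ram M"
    then have "\<exists>X Y. X \<subseteq> P \<and> Y \<subseteq> Low \<and> T \<le> card X \<and> card X \<le> M \<and> card Y = T \<and> homog E X \<and> homog E Y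
           \<and> (\<forall>x\<in>X. \<forall>y\<in>Y. x \<noteq> y \<and> \<not> E x y)"
      by (intro homogeneous_pair[OF finP finite_Low card_le_N[OF Low_sub] \<eta> T_pos _
            fills_subset[OF fills_Low[OF T_le_M] PL] fills_Low[OF order_refl] _ M large(1)])
        (simp_all add: P_def)
    then obtain X Y where "X \<subseteq> P" "Y \<subseteq> Low" "T \<le> card X" "card Y = T" "homog E X" "homog E Y"
      "\<forall>x\<in>X. \<forall>y\<in>Y. x \<noteq> y \<and> \<not> E x y" by blast
    then show False using no_blue_bipartite_Low[of X Y] order_trans[OF _ PL] by simp
  qed
  then have P_le: "real (card P) + 1 \<le> \<eta> * N" using large(4) by linarith
  have "deg_Low z \<ge> l - 1 - \<eta> * N - (if z \<in> P then N else 0)" if z: "z \<in> Low" for z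
  proof -
    have "Low \<subseteq> {y \<in> Low. E z y} \<union> insert z {y \<in> Low. z \<noteq> y \<and> \<not> E z y}" by auto
    then have "card Low \<le> card ({y \<in> Low. E z y} \<union> insert z {y \<in> Low. z \<noteq> y \<and> \<not> E z y})"
      using finite_Low by (intro card_mono) auto
    also have "\<dots> \<le> card {y \<in> Low. E z y} + (1 + card {y \<in> Low. z \<noteq> y \<and> \<not> E z y})"
      by (rule order_trans[OF card_Un_le]) (use finite_Low in auto)
    finally have "l \<le> deg_Low z + 1 + real (card {y \<in> Low. z \<noteq> y \<and> \<not> E z y})"
      unfolding deg_Low_def by linarith
    moreover have "real (card {y \<in> Low. z \<noteq> y \<and> \<not> E z y}) \<le> N"
      using Low_sub by (intro card_le_N) auto
    moreover have "z \<notin> P \<Longrightarrow> real (card {y \<in> Low. z \<noteq> y \<and> \<not> E z y}) \<le> \<eta> * N"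
      using z by (auto simp: P_def)
    ultimately show ?thesis using err_pos by (cases "z \<in> P") auto
  qed
  then have "(\<Sum>z\<in>Low. l - 1 - \<eta> * N - (if z \<in> P then N else 0)) \<le> (\<Sum>z\<in>Low. deg_Low z)"
    by (intro sum_mono) auto
  moreover have "(\<Sum>z\<in>Low. l - 1 - \<eta> * N - (if z \<in> P then N else 0))
      = l * (l - 1 - \<eta> * N) - real (card P) * N"
  proof -
    have "Low \<inter> P = P" using PL by auto
    then show ?thesis
      using finite_Low by (simp add: sum_subtractf[of _ "\<lambda>z. if z \<in> P then N else 0"] flip: sum.inter_restrict)
  qed
  moreover have "l * (1 + \<eta> * N) \<le> N * (1 + \<eta> * N)"
    using card_le_N[OF Low_sub] err_pos by (intro mult_right_mono) auto
  moreover have "(real (card P) + 1) * N \<le> (\<eta> * N) * N"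
    using P_le N_pos by (intro mult_right_mono) auto
  ultimately show ?thesis by (simp add: algebra_simps)
qed

lemma sum_deg_split: "(\<Sum>z\<in>Low. deg z) = (\<Sum>z\<in>Low. deg_Low z) + (\<Sum>x\<in>High. deg_Low x)"
proof -
  have "deg z = deg_Low z + real (card {x \<in> High. E x z})" for z
  proof -
    have "{v \<in> V. E z v} = {y \<in> Low. E z y} \<union> {x \<in> High. E x z}"
      using V_split(1) by (auto simp: E_commute)
    moreover have "{y \<in> Low. E z y} \<inter> {x \<in> High. E x z} = {}" using V_split(2) by auto
    ultimately show ?thesis
      using finite_High finite_Low by (simp add: deg_def deg_Low_def card_Un_disjoint)
  qed
  moreover have "(\<Sum>z\<in>Low. card {x \<in> High. E x z}) = (\<Sum>x\<in>High. card {z \<in> Low. E x z})"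
    by (rule sum_multicount_gen[OF finite_Low finite_High, symmetric, THEN sym]) simp
  then have "(\<Sum>z\<in>Low. real (card {x \<in> High. E x z})) = (\<Sum>x\<in>High. deg_Low x)"
    by (simp add: deg_Low_def flip: of_nat_sum)
  ultimately show ?thesis by (simp add: sum.distrib)
qed

lemma sum_deg_le: "(\<Sum>z\<in>Low. deg z) \<le> threshold * l"
  using sum_bounded_above[of Low deg threshold] by (simp add: Low_def mult.commute)

lemma threshold_le: "threshold \<le> 2 / 3 * N"
  using weight B_nonneg err_pos unfolding threshold_def by linarith

text \<open>Since \<open>Low\<close> is almost a red clique, its vertices have red degree at least about \<open>l\<close> on average,
while the threshold is at most \<open>2N/3\<close>.\<close>

lemma High_large: "N / 10 \<le> h"
proof (rule ccontr)
  assume "\<not> N / 10 \<le> h"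
  then have l: "9 / 10 * N < l" using h_plus_l by linarith
  have "0 \<le> (\<Sum>x\<in>High. deg_Low x)" by (simp add: deg_Low_def sum_nonneg)
  then have "l * l - 2 * (\<eta> * N) * N \<le> threshold * l"
    using sum_deg_Low_in_Low sum_deg_split sum_deg_le by linarith
  also have "\<dots> \<le> 2 / 3 * N * l" using threshold_le by (intro mult_right_mono) auto
  finally have "l * (l - 2 / 3 * N) \<le> 2 * (\<eta> * N) * N" by (simp add: algebra_simps)
  moreover have "9 / 10 * N * (7 / 30 * N) \<le> l * (l - 2 / 3 * N)"
    using l N_pos by (intro mult_mono) auto
  moreover have "3200 * \<eta> * (N * N) \<le> 1 * (N * N)" using eta_small by (intro mult_right_mono) auto
  moreover have "0 < N * N" using N_pos by simp
  ultimately show False by (simp add: algebra_simps)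
qed

text \<open>For a clique \<open>X\<close>, the average of \<open>gain\<close> over \<open>X\<close> is a lower bound for the part of
\<open>\<Sum>(1 - w\<^sub>X)\<^sup>2\<close> that comes from \<open>Low\<close>. Using the tangent of the square makes this bound linear in
the vertices of \<open>X\<close>.\<close>

definition gain :: "'a \<Rightarrow> real" where "gain x = 8 / 9 * l - 4 / 3 * deg_Low x"

text \<open>If two blue cliques \<open>X\<close>, \<open>Y\<close> are joined in red, then the vertices of \<open>High\<close> contribute about
\<open>h\<close> to \<open>\<Sum>(1 - w\<^sub>X)\<^sup>2 + \<Sum>(1 - w\<^sub>Y)\<^sup>2 \<le> 2B\<close>, which leaves \<open>2B - h\<close> for the two gains.\<close>

definition pivot :: real where "pivot = B - h / 2 + 4 * (\<eta> * N)"

text \<open>Vertices of \<open>Low\<close> have few red neighbours in \<open>High\<close>, because most of their small red degree is used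
up inside \<open>Low\<close>. Hence the gain is at least \<open>Bl/N\<close> on average over \<open>High\<close>, and this exceeds
\<open>B - h/2\<close> by \<open>h(1/2 - B/N)\<close>, which the margin in \<open>2B < N\<close> makes larger than all the errors.\<close>

lemma sum_gain: "8 * (\<eta> * N) * N \<le> (\<Sum>x\<in>High. gain x - pivot)"
proof -
  have "(\<Sum>x\<in>High. deg_Low x) \<le> threshold * l - l * l + 2 * (\<eta> * N) * N"
    using sum_deg_Low_in_Low sum_deg_split sum_deg_le by linarith
  (* since threshold <= N, the terms threshold l - l^2 are at most (threshold/N) l h *)
  moreover have "N * (threshold * l - l * l) \<le> threshold * l * h"
  proof -
    have "l * l * threshold \<le> l * l * N" using threshold_le N_pos by (intro mult_left_mono) auto
    moreover have "N * (threshold * l) = threshold * l * h + threshold * l * l" by (simp add: algebra_simps flip: h_plus_l)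
    ultimately show ?thesis by (simp add: algebra_simps)
  qed
  ultimately have "N * (\<Sum>x\<in>High. deg_Low x) \<le> threshold * l * h + 2 * (\<eta> * N) * N * N"
    using mult_left_mono[of "(\<Sum>x\<in>High. deg_Low x)" "threshold * l - l * l + 2 * (\<eta> * N) * N" N] N_pos
    by (simp add: algebra_simps)
  moreover have "N * (\<Sum>x\<in>High. gain x) = 8 / 9 * N * l * h - 4 / 3 * (N * (\<Sum>x\<in>High. deg_Low x))"
    unfolding gain_def sum_subtractf sum_distrib_left[symmetric] by (simp add: algebra_simps)
  ultimately have "l * h * (8 / 9 * N - 4 / 3 * threshold) - 8 / 3 * (\<eta> * N) * N * N \<le> N * (\<Sum>x\<in>High. gain x)"
    by (simp add: algebra_simps)
  moreover have "l * h * B \<le> l * h * (8 / 9 * N - 4 / 3 * threshold)"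
    using B_le_tangent err_pos by (intro mult_left_mono) auto
  ultimately have lower: "l * h * B - 8 / 3 * (\<eta> * N) * N * N \<le> N * (\<Sum>x\<in>High. gain x)" by linarith
  have "N * (\<Sum>x\<in>High. gain x - pivot) = N * (\<Sum>x\<in>High. gain x) - N * h * pivot"
    by (simp add: sum_subtractf algebra_simps)
  moreover have "l * h * B - N * h * pivot = h * h * (N / 2 - B) - 4 * (\<eta> * N) * h * N"
    by (simp add: pivot_def algebra_simps flip: h_plus_l)
  moreover have "N / 10 * (N / 10) * (1600 * (\<eta> * N)) \<le> h * h * (N / 2 - B)"
    using High_large half err_pos N_pos by (intro mult_mono) auto
  moreover have "4 * (\<eta> * N) * h * N \<le> 4 * (\<eta> * N) * N * N"
    using card_le_N[OF High_sub] err_pos N_pos by (intro mult_right_mono mult_left_mono) auto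
  moreover have "N / 10 * (N / 10) * (1600 * (\<eta> * N)) = 16 * (\<eta> * N) * N * N" by simp
  moreover have "0 < \<eta> * N * N * N" using err_pos N_pos by simp
  (* the error terms add up to 16 - 4 - 8/3 >= 8 *)
  ultimately have "N * (8 * (\<eta> * N) * N) \<le> N * (\<Sum>x\<in>High. gain x - pivot)"
    using lower by (simp add: algebra_simps)
  then show ?thesis using N_pos by simp
qed

lemma sum_Low_ge: "0 < card X \<Longrightarrow> avg X gain \<le> (\<Sum>z\<in>Low. (1 - red_share X z)\<^sup>2)"
proof -
  assume X: "0 < card X"
  have "avg X gain = (\<Sum>z\<in>Low. 8 / 9 - 4 / 3 * red_share X z)"
    unfolding gain_def[abs_def] avg_diff avg_mult avg_const[OF X] sum_subtractf sum_distrib_left[symmetric] 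
      sum_red_share[OF Low_sub] deg_Low_def[abs_def] by simp
  also have "\<dots> \<le> (\<Sum>z\<in>Low. (1 - red_share X z)\<^sup>2)" by (intro sum_mono square_ge_tangent)
  finally show ?thesis .
qed

text \<open>Many such vertices would contain a large set with the same trace on \<open>X \<union> Y\<close>, and a blue clique in
that set would complete the configuration excluded by \<open>no_red_tripartite\<close>.\<close>

lemma few_common:
  assumes sub: "X \<subseteq> High" "Y \<subseteq> High" and card: "T1 \<le> card X" "card X \<le> M1" "card Y = T1"
    and blue: "homog blue X" "homog blue Y" and red: "\<forall>x\<in>X. \<forall>y\<in>Y. E x y"
  shows "real (card {v \<in> High. \<eta> \<le> red_share X v \<and> \<eta> \<le> red_share Y v}) \<le> \<eta> * N"
proof (rule ccontr)
  define Q where "Q = {v \<in> High. \<eta> \<le> red_share X v \<and> \<eta> \<le> red_share Y v}"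
  assume "\<not> ?thesis"
  then have Q: "\<eta> * N < real (card Q)" by (simp add: Q_def)
  have fin: "finite X" "finite Y" "finite Q"
    using sub finite_High finite_subset by (auto simp: Q_def)
  have "card (X \<union> Y) \<le> M1 + T1" using card_Un_le[of X Y] card by linarith
  then have "(2 :: real) ^ card (X \<union> Y) * real (ram T) \<le> 2 ^ (M1 + T1) * real (ram T)"
    by (intro mult_right_mono power_increasing) auto
  then have "real (2 ^ card (X \<union> Y) * ram T) < real (card Q)" using large(3) Q by simp
  then have "2 ^ card (X \<union> Y) * ram T < card Q" unfolding of_nat_less_iff .
  then obtain S where S: "ram T \<le> card {v \<in> Q. {x \<in> X \<union> Y. E x v} = S}"
    using common_trace[of "X \<union> Y" Q "ram T" E] fin by blast
  have QH: "{v \<in> Q. {x \<in> X \<union> Y. E x v} = S} \<subseteq> High" by (auto simp: Q_def)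
  then obtain Z where Z: "Z \<subseteq> {v \<in> Q. {x \<in> X \<union> Y. E x v} = S}" "card Z = T" "homog blue Z"
    using fills_High[OF order_refl] S unfolding fills_def by meson
  obtain z where z: "z \<in> Z" using Z(2) T_pos by fastforce
  have big: "T \<le> card (W \<inter> S)" if W: "W \<subseteq> X \<union> Y" "T1 \<le> card W" "\<eta> \<le> red_share W z" for W
  proof -
    have W0: "0 < real (card W)" and finW: "finite W"
      using W T_le_T1 T_pos fin finite_subset[of W "X \<union> Y"] by auto
    have "W \<inter> S = {x \<in> W. E x z}" using Z(1) z W(1) by auto
    then have "red_share W z = real (card (W \<inter> S)) / real (card W)"
      using finW by (simp add: red_share_def avg_def Int_def)
    then have "\<eta> * real (card W) \<le> real (card (W \<inter> S))"
      using mult_right_mono[OF W(3), of "real (card W)"] W0 by simp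
    moreover have "\<eta> * real T1 \<le> \<eta> * real (card W)" using W(2) \<eta> by simp
    ultimately show ?thesis using T1 by linarith
  qed
  have zQ: "\<eta> \<le> red_share X z" "\<eta> \<le> red_share Y z" using Z(1) z by (auto simp: Q_def)
  show False
  proof (rule no_red_tripartite[of "X \<inter> S" "Y \<inter> S" Z])
    show "T \<le> card (X \<inter> S)" "T \<le> card (Y \<inter> S)" using big[of X] big[of Y] zQ card by auto
    show "homog blue (X \<inter> S)" "homog blue (Y \<inter> S)" "homog blue Z" 
      using homog_subset[OF blue(1), of "X \<inter> S"] homog_subset[OF blue(2), of "Y \<inter> S"] Z(3) by auto
    show "X \<inter> S \<subseteq> V" "Y \<inter> S \<subseteq> V" "Z \<subseteq> V" using sub High_sub Z(1) QH by auto
    show "\<forall>x\<in>X \<inter> S. \<forall>y\<in>Y \<inter> S. E x y" using red by auto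
    show "\<forall>x\<in>X \<inter> S. \<forall>z\<in>Z. E x z" "\<forall>x\<in>Y \<inter> S. \<forall>z\<in>Z. E x z" using Z(1) by auto
    show "T \<le> card Z" using Z(2) by simp
  qed
qed

text \<open>Almost every vertex of \<open>High\<close> has a red share below \<open>\<eta>\<close> in \<open>X\<close> or in \<open>Y\<close>, and so contributes almost
1 to \<open>(1 - w\<^sub>X)\<^sup>2 + (1 - w\<^sub>Y)\<^sup>2\<close>.\<close>

lemma red_pair_gain:
  assumes sub: "X \<subseteq> High" "Y \<subseteq> High" and card: "T1 \<le> card X" "card X \<le> M1" "card Y = T1"
    and blue: "homog blue X" "homog blue Y" and red: "\<forall>x\<in>X. \<forall>y\<in>Y. E x y"
  shows "avg X gain + avg Y gain < 2 * pivot"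
proof -
  have subV: "X \<subseteq> V" "Y \<subseteq> V" using sub High_sub by auto
  have cardT: "T \<le> card X" "T \<le> card Y" using card T_le_T1 by auto
  have pos: "0 < card X" "0 < card Y" using cardT T_pos by auto
  define Q where "Q = {v \<in> High. \<eta> \<le> red_share X v \<and> \<eta> \<le> red_share Y v}"
  have Q: "real (card Q) \<le> \<eta> * N" unfolding Q_def by (rule few_common[OF assms])
  have QH: "High \<inter> Q = Q" by (auto simp: Q_def)
  have "1 - 2 * \<eta> - (if v \<in> Q then 1 else 0) \<le> (1 - red_share X v)\<^sup>2 + (1 - red_share Y v)\<^sup>2"
    if v: "v \<in> High" for v
  proof (cases "v \<in> Q")
    case True
    then show ?thesis using \<eta> by (auto intro: add_nonneg_nonneg order_trans[of _ 0])
  next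
    case False
    have small: "1 - 2 * \<eta> \<le> (1 - x)\<^sup>2" if "x < \<eta>" for x :: real
    proof -
      have "(1 - \<eta>)\<^sup>2 \<le> (1 - x)\<^sup>2" using that eta_small by (intro power_mono) auto
      moreover have "1 - 2 * \<eta> \<le> (1 - \<eta>)\<^sup>2" by (simp add: power2_diff)
      ultimately show ?thesis by linarith
    qed
    from False v have "red_share X v < \<eta> \<or> red_share Y v < \<eta>" by (auto simp: Q_def)
    moreover have "1 - 2 * \<eta> - (if v \<in> Q then 1 else 0) = 1 - 2 * \<eta>" using False by simp
    ultimately show ?thesis
      using small[of "red_share X v"] small[of "red_share Y v"] 
        zero_le_power2[of "1 - red_share X v"] zero_le_power2[of "1 - red_share Y v"]
      by linarith
  qed
  then have "(\<Sum>v\<in>High. 1 - 2 * \<eta> - (if v \<in> Q then 1 else 0)) 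
      \<le> (\<Sum>v\<in>High. (1 - red_share X v)\<^sup>2 + (1 - red_share Y v)\<^sup>2)"
    by (rule sum_mono)
  moreover have "(\<Sum>v\<in>High. 1 - 2 * \<eta> - (if v \<in> Q then 1 else 0)) = h * (1 - 2 * \<eta>) - real (card Q)"
    using finite_High QH by (simp add: sum_subtractf[of _ "\<lambda>v. if v \<in> Q then 1 else 0"] flip: sum.inter_restrict)
  moreover have "h * \<eta> \<le> \<eta> * N" using card_le_N[OF High_sub] \<eta> by simp
  ultimately have "h - 3 * (\<eta> * N) \<le> (\<Sum>v\<in>High. (1 - red_share X v)\<^sup>2) + (\<Sum>v\<in>High. (1 - red_share Y v)\<^sup>2)"
    using Q by (simp add: sum.distrib algebra_simps)
  moreover have pivot2: "2 * pivot = 2 * B - h + 8 * (\<eta> * N)" by (simp add: pivot_def)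
  ultimately show ?thesis
    using blue_clique_le[OF subV(1) cardT(1) blue(1)] blue_clique_le[OF subV(2) cardT(2) blue(2)]
      sum_Low_ge[OF pos(1)] sum_Low_ge[OF pos(2)] err_pos
    unfolding sum_split pivot2 by linarith
qed

text \<open>At a suitable level \<open>s\<close>, the set \<open>I\<close> of vertices with gain above \<open>pivot + s\<close> is larger than the set
\<open>J\<close> of vertices with gain below \<open>pivot - s\<close>. Red pairs of cliques between \<open>I\<close> and \<open>High - J\<close> would
have too large a total gain, so some blue clique in \<open>I\<close> has few red edges to \<open>High - J\<close>. As
\<open>J\<close> is at most half of \<open>High\<close>, this clique violates the bound for blue cliques.\<close>

theorem contradiction: False
proof -
  define k where "k = ram M1 + ram T"
  have gain_le: "gain x - pivot \<le> N" for x
  proof -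
    have "0 \<le> deg_Low x" by (simp add: deg_Low_def)
    moreover have "0 \<le> l" "0 \<le> h" by auto
    ultimately show ?thesis
      using B_nonneg h_plus_l err_pos unfolding gain_def pivot_def by linarith
  qed
  (* k is bounded in terms of \<eta>, so k exceptions cannot account for the sum of the gains *)
  have "real k * N < \<eta> * N * N" using large(5) N_pos by (simp add: k_def)
  moreover have "0 < \<eta> * N * N" using err_pos N_pos by simp
  ultimately have "\<not> (\<Sum>x\<in>High. gain x - pivot) \<le> real k * N" using sum_gain by linarith
  then obtain s where s: "0 \<le> s"
      "card {x \<in> High. gain x - pivot < - s} + k < card {x \<in> High. s < gain x - pivot}"
    using level_pairing[OF finite_High, of N "\<lambda>x. gain x - pivot" k] gain_le
    by (meson linorder_not_le of_nat_0_le_iff)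
  define I where "I = {x \<in> High. s < gain x - pivot}"
  define J where "J = {x \<in> High. gain x - pivot < - s}"
  define Q where "Q = High - J"
  define P where "P = {x \<in> I. \<eta> * N \<le> real (card {y \<in> Q. E x y})}"
  have fin: "finite I" "finite J" "finite Q" "finite P"
    using finite_High by (auto simp: I_def J_def Q_def P_def)
  have subH: "I \<subseteq> High" "J \<subseteq> High" "Q \<subseteq> High" "P \<subseteq> I" by (auto simp: I_def J_def Q_def P_def)
  have "card P < ram M1"
  proof (rule ccontr)
    assume "\<not> card P < ram M1"
    then have "\<exists>X Y. X \<subseteq> P \<and> Y \<subseteq> Q \<and> T1 \<le> card X \<and> card X \<le> M1 \<and> card Y = T1 \<and> homog blue X \<and> homog blue Y
           \<and> (\<forall>x\<in>X. \<forall>y\<in>Y. E x y)"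
      using T_le_T1 T1_le_M1 T_pos
      by (intro homogeneous_pair[OF fin(4,3) card_le_N[OF order_trans[OF subH(3) High_sub]] \<eta> _ _
            fills_subset[OF fills_High order_trans[OF subH(4,1)]]
            fills_subset[OF fills_High[OF T_le_T1] subH(3)] _ M1 large(2)])
        (simp_all add: P_def)
    then obtain X Y where XY: "X \<subseteq> P" "Y \<subseteq> Q" "T1 \<le> card X" "card X \<le> M1" "card Y = T1"
      "homog blue X" "homog blue Y" "\<forall>x\<in>X. \<forall>y\<in>Y. E x y" by blast
    have pos: "0 < card X" "0 < card Y" using XY T_le_T1 T_pos by auto
    have "pivot + s \<le> avg X gain" using XY(1) pos subH by (intro avg_ge) (auto simp: I_def)
    moreover have "pivot - s \<le> avg Y gain" using XY(2) pos by (intro avg_ge) (auto simp: Q_def J_def)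
    moreover have "avg X gain + avg Y gain < 2 * pivot" 
      using XY subH by (intro red_pair_gain) auto
    ultimately show False by simp
  qed
  moreover have "card (I - P) = card I - card P" using fin subH by (intro card_Diff_subset) auto
  ultimately have "ram T \<le> card (I - P)" using s(2) by (simp add: I_def k_def)
  then obtain X where X: "X \<subseteq> I - P" "card X = T" "homog blue X"
    using fills_High[OF order_refl] subH unfolding fills_def by (meson Diff_subset order_trans)
  have pos: "0 < card X" using X(2) T_pos by simp
  have "avg X (\<lambda>x. real (card {v \<in> Q. E x v})) \<le> \<eta> * N"
    using X(1) pos by (intro avg_le) (auto simp: P_def)
  then have wQ: "(\<Sum>v\<in>Q. red_share X v) \<le> \<eta> * N" using sum_red_share[of Q X] subH High_sub by auto
  have "real (card Q) - 2 * (\<eta> * N) \<le> (\<Sum>v\<in>Q. 1 - 2 * red_share X v)"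
    using wQ by (simp add: sum_subtractf flip: sum_distrib_left)
  also have "\<dots> \<le> (\<Sum>v\<in>Q. (1 - red_share X v)\<^sup>2)"
    by (intro sum_mono) (simp add: power2_diff)
  also have "\<dots> \<le> (\<Sum>v\<in>High. (1 - red_share X v)\<^sup>2)"
    using finite_High subH by (intro sum_mono2) auto
  finally have High: "real (card Q) - 2 * (\<eta> * N) \<le> (\<Sum>v\<in>High. (1 - red_share X v)\<^sup>2)" .
  have "pivot + s \<le> avg X gain" using X(1) pos by (intro avg_ge) (auto simp: I_def)
  moreover have "real (card Q) = h - real (card J)"
    using fin subH finite_High by (simp add: Q_def card_Diff_subset card_mono of_nat_diff)
  moreover have "real (card J) \<le> h / 2"
  proof -
    have "I \<inter> J = {}" using s(1) by (auto simp: I_def J_def)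
    then have "card I + card J \<le> card High"
      using fin subH card_mono[OF finite_High, of "I \<union> J"] by (simp add: card_Un_disjoint)
    moreover have "card J < card I" using s(2) by (simp add: I_def J_def)
    ultimately show ?thesis by linarith
  qed
  moreover have "X \<subseteq> V" using X(1) subH High_sub by auto
  ultimately show False
    using blue_clique_le[of X] X(2,3) sum_Low_ge[OF pos] High s(1) err_pos
    unfolding sum_split pivot_def by simp
qed

end

section \<open>Supercritical colourings have bounded size\<close>

lemma ex_nat_ge_mult: "0 < \<eta> \<Longrightarrow> \<exists>m::nat. x \<le> \<eta> * real m" for \<eta> x :: real
  using real_arch_simple[of "x / \<eta>"] by (auto simp: field_simps)

text \<open>The constants are chosen in the order \<open>T\<close>, \<open>T1\<close>, \<open>M\<close>, \<open>M1\<close>, and the vertex set only has to be large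
compared with the Ramsey bounds for them.\<close>

theorem no_large_supercritical:
  fixes \<epsilon> :: real
  assumes "0 < \<epsilon>"
  shows "\<exists>n0. \<forall>(V :: 'a set) E A B. codegree_bounded V E A B \<longrightarrow>
           6 * A + 3 * B + \<epsilon> * real (card V) \<le> 2 * real (card V) \<longrightarrow>
           2 * B + \<epsilon> * real (card V) \<le> real (card V) \<longrightarrow> real (card V) < n0"
proof -
  define \<eta> where "\<eta> = \<epsilon> / 3200"
  have \<eta>: "0 < \<eta>" using assms by (simp add: \<eta>_def)
  obtain ram where ram: "\<And>t (E :: 'a \<Rightarrow> 'a \<Rightarrow> bool) Q. symp E \<Longrightarrow> finite Q \<Longrightarrow> ram t \<le> card Q \<Longrightarrow>
     (\<exists>X\<subseteq>Q. card X = t \<and> (homog E X \<or> homog (\<lambda>x y. \<not> E x y) X))"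
    using ramsey_homog by metis
  obtain T where T: "1 \<le> \<eta> * real T" using ex_nat_ge_mult[OF \<eta>] by blast
  obtain T1 where T1: "real T \<le> \<eta> * real T1" using ex_nat_ge_mult[OF \<eta>] by blast
  obtain M where M: "2 * real T \<le> \<eta> * real M" using ex_nat_ge_mult[OF \<eta>] by blast
  obtain M1 where M1: "2 * real T1 \<le> \<eta> * real M1" using ex_nat_ge_mult[OF \<eta>] by blast
  define K where "K = 1 + 2 * (2 ^ M * real (ram T)) + 2 * (2 ^ M1 * real (ram T1))
    + 2 ^ (M1 + T1) * real (ram T) + (real (ram M) + 1) + (real (ram M1) + real (ram T) + 1)"
  have "real (card V) < K / \<eta>"
    if cb: "codegree_bounded V E A B" and weight: "6 * A + 3 * B + \<epsilon> * real (card V) \<le> 2 * real (card V)"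
      and half: "2 * B + \<epsilon> * real (card V) \<le> real (card V)" for V :: "'a set" and E A B
  proof (rule ccontr)
    interpret codegree_bounded V E A B by (rule cb)
    assume "\<not> ?thesis"
    then have K: "K \<le> \<eta> * N" using \<eta> by (simp add: field_simps)
    have nonneg: "0 \<le> 2 ^ M * real (ram T)" "0 \<le> 2 ^ M1 * real (ram T1)" "0 \<le> 2 ^ (M1 + T1) * real (ram T)"
      by simp_all
    have one: "1 \<le> \<eta> * N" using K nonneg unfolding K_def by linarith
    have large: "2 ^ M * real (ram T) < \<eta> * N / 2" "2 ^ M1 * real (ram T1) < \<eta> * N / 2"
      "2 ^ (M1 + T1) * real (ram T) < \<eta> * N" "real (ram M) + 1 \<le> \<eta> * N"
      "real (ram M1) + real (ram T) + 1 \<le> \<eta> * N"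
      using K nonneg unfolding K_def by linarith+
    have "0 < card V" using one by (cases "card V = 0") auto
    moreover have "\<epsilon> * N = 3200 * (\<eta> * N)" by (simp add: \<eta>_def)
    ultimately interpret supercritical_ramsey V E A B \<eta> T ram T1 M M1
      using \<eta> weight half T T1 M M1 large ram[OF symp_E] finite_subset[OF _ finite_V]
      by unfold_locales auto
    show False by (rule contradiction)
  qed
  then show ?thesis by blast
qed

section \<open>Books and codegrees\<close>

lemma contains_bookI:
  assumes W: "finite W" and xy: "x \<in> W" "y \<in> W" "x \<noteq> y" "{x, y} \<in> F"
    and pages: "S \<subseteq> {v \<in> W. {x, v} \<in> F \<and> {y, v} \<in> F} - {x, y}" "m \<le> card S"
  shows "contains_copy (W, F) (book m)"
proof -
  obtain P where P: "P \<subseteq> S" "card P = m" "finite P"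
    using obtain_subset_with_card_n[OF pages(2)] by metis
  obtain b where b: "bij_betw b {2..<m + 2} P"
    using finite_same_card_bij[of "{2..<m + 2}" P] P by auto
  define f where "f i = (if i = 0 then x else if i = 1 then y else b i)" for i :: nat
  have bP: "b i \<in> P" if "i \<in> {2..<m + 2}" for i using b that by (auto simp: bij_betw_def)
  have Pxy: "x \<notin> P" "y \<notin> P" using P(1) pages(1) by auto
  have verts: "{..<m + 2} = {0, 1} \<union> {2..<m + 2}" by auto
  have f_b: "f i = b i" if "i \<in> {2..<m + 2}" for i using that by (simp add: f_def)
  have "inj_on f {2..<m + 2}"
    using b f_b by (simp add: bij_betw_def inj_on_def)
  moreover have "f ` {2..<m + 2} \<subseteq> P" using f_b bP by auto
  moreover have "inj_on f {0, 1}" using xy(3) by (simp add: f_def)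
  moreover have "f ` {0, 1} = {x, y}" by (auto simp: f_def)
  moreover from calculation have "f ` {0, 1} \<inter> f ` {2..<m + 2} = {}" using Pxy by auto
  ultimately have "inj_on f {..<m + 2}"
    unfolding verts inj_on_Un by blast
  moreover have "f ` {..<m + 2} \<subseteq> W"
  proof -
    have "P \<subseteq> W" using P(1) pages(1) by auto
    with \<open>f ` {2..<m + 2} \<subseteq> P\<close> have "f ` {2..<m + 2} \<subseteq> W" by (rule order_trans)
    moreover have "f ` {0, 1} \<subseteq> W" unfolding \<open>f ` {0, 1} = {x, y}\<close> using xy(1,2) by simp
    ultimately show ?thesis unfolding verts image_Un by (rule Un_least[rotated])
  qed
  moreover have "f ` e \<in> F" if "e \<in> snd (book m)" for e
  proof -
    from that consider "e = {0, 1}" | i where "i \<in> {2..<m + 2}" "e = {0, i} \<or> e = {1, i}"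
      by (auto simp: book_def)
    then show ?thesis
    proof cases
      case 1
      then show ?thesis using xy(4) by (simp add: f_def insert_commute)
    next
      case 2
      then have "b i \<in> S" using bP P(1) by auto
      then have "{x, b i} \<in> F" "{y, b i} \<in> F" using pages(1) by auto
      moreover have "f ` {0, i} = {x, b i}" "f ` {1, i} = {y, b i}"
        using 2(1) by (auto simp: f_def)
      ultimately show ?thesis using 2(2) by metis
    qed
  qed
  ultimately show ?thesis
    unfolding contains_copy_def by (intro exI[of _ f]) (auto simp: book_def)
qed

lemma contains_bookE:
  assumes "contains_copy (W, F) (book m)" "finite W"
  obtains x y where "x \<in> W" "y \<in> W" "x \<noteq> y" "{x, y} \<in> F"
    "m \<le> card ({v \<in> W. {x, v} \<in> F \<and> {y, v} \<in> F} - {x, y})"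
proof -
  obtain f where f: "inj_on f {..<m + 2}" "f ` {..<m + 2} \<subseteq> W" "\<And>e. e \<in> snd (book m) \<Longrightarrow> f ` e \<in> F"
    using assms(1) unfolding contains_copy_def by (auto simp del: image_insert simp: book_def)
  have "f i \<in> {v \<in> W. {f 0, v} \<in> F \<and> {f 1, v} \<in> F} - {f 0, f 1}" if i: "i \<in> {2..<m + 2}" for i
  proof -
    have "{0, i} \<in> snd (book m)" "{1, i} \<in> snd (book m)" using i by (auto simp: book_def)
    then have "f ` {0, i} \<in> F" "f ` {1, i} \<in> F" by (simp_all only: f(3))
    moreover have "f i \<noteq> f 0" "f i \<noteq> f 1" "f i \<in> W"
      using i f(2) inj_onD[OF f(1), of i 0] inj_onD[OF f(1), of i 1] by auto
    ultimately show ?thesis by simp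
  qed
  then have "f ` {2..<m + 2} \<subseteq> {v \<in> W. {f 0, v} \<in> F \<and> {f 1, v} \<in> F} - {f 0, f 1}"
    by (intro image_subsetI)
  moreover have "card (f ` {2..<m + 2}) = m"
  proof -
    have "{2..<m + 2} \<subseteq> {..<m + 2}" by auto
    from card_image[OF inj_on_subset[OF f(1) this]] show ?thesis by simp
  qed
  ultimately have "m \<le> card ({v \<in> W. {f 0, v} \<in> F \<and> {f 1, v} \<in> F} - {f 0, f 1})"
    using card_mono[of "{v \<in> W. {f 0, v} \<in> F \<and> {f 1, v} \<in> F} - {f 0, f 1}" "f ` {2..<m + 2}"] assms(2)
    by auto
  moreover have "f 0 \<noteq> f 1" using inj_onD[OF f(1), of 0 1] by auto
  moreover have "{f 0, f 1} \<in> F" using f(3)[of "{0, 1}"] by (simp add: book_def)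
  moreover have "f 0 \<in> W" "f 1 \<in> W" using f(2) by auto
  ultimately show ?thesis using that by blast
qed

text \<open>The bound \<open>n + 1\<close> is \<open>(n - 1) + 2\<close>: the two ends of a blue edge are counted as well.\<close>

lemma codegree_bounded_if_not_arrows:
  assumes "\<not> ramsey_arrows N (book m) (book n)"
  shows "\<exists>E. codegree_bounded {..<N} E (real m) (real n + 1)"
proof -
  obtain R where R: "R \<subseteq> nsets {..<N} 2" and red: "\<not> contains_copy ({..<N}, R) (book m)"
    and blue: "\<not> contains_copy ({..<N}, nsets {..<N} 2 - R) (book n)"
    using assms unfolding ramsey_arrows_def by blast
  define E where "E x y \<longleftrightarrow> {x, y} \<in> R" for x y
  have irr: "\<not> E x x" for x
  proof
    assume "E x x"
    then have "{x, x} \<in> nsets {..<N} 2" using R by (auto simp: E_def)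
    then show False by (simp add: nsets_def)
  qed
  have "codegree_bounded {..<N} E (real m) (real n + 1)"
  proof
    show "symp E" by (auto simp: symp_def E_def insert_commute)
    show "\<not> E x x" for x by (rule irr)
    fix x y assume xy: "x \<in> {..<N}" "y \<in> {..<N}"
    show "real (card {v \<in> {..<N}. E x v \<and> E y v}) \<le> real m" if "E x y"
    proof (rule ccontr)
      assume "\<not> ?thesis"
      then have "m \<le> card {v \<in> {..<N}. E x v \<and> E y v}" by simp
      moreover have "{v \<in> {..<N}. E x v \<and> E y v} \<subseteq> {v \<in> {..<N}. {x, v} \<in> R \<and> {y, v} \<in> R} - {x, y}"
        using irr by (auto simp: E_def)
      moreover have "x \<noteq> y" using that irr by auto
      ultimately show False
        using red contains_bookI[of "{..<N}" x y R] xy that by (auto simp: E_def)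
    qed
    show "real (card {v \<in> {..<N}. \<not> E x v \<and> \<not> E y v}) \<le> real n + 1" if "x \<noteq> y" "\<not> E x y"
    proof (rule ccontr)
      define S where "S = {v \<in> {..<N}. \<not> E x v \<and> \<not> E y v}"
      assume "\<not> ?thesis"
      then have "n + 2 \<le> card S" by (simp add: S_def)
      moreover have "card S - card {x, y} \<le> card (S - {x, y})" by (rule diff_card_le_card_Diff) simp
      ultimately have "n \<le> card (S - {x, y})" using that by simp
      moreover have "S - {x, y} \<subseteq> {v \<in> {..<N}. {x, v} \<in> nsets {..<N} 2 - R \<and> {y, v} \<in> nsets {..<N} 2 - R} - {x, y}"
        using xy by (auto simp: S_def E_def)
      ultimately show False
        using blue contains_bookI[of "{..<N}" x y "nsets {..<N} 2 - R" "S - {x, y}" n] xy that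
        by (auto simp: E_def)
    qed
  qed auto
  then show ?thesis by blast
qed

text \<open>The colouring of \<open>{..<N}\<close> is restricted to the vertices below \<open>ramsey_number (book m) (book n)\<close>,
where only fewer pages are possible.\<close>

lemma ramsey_number_books_gt:
  assumes sym: "symp E"
    and red: "\<And>x y. x < N \<Longrightarrow> y < N \<Longrightarrow> x \<noteq> y \<Longrightarrow> E x y \<Longrightarrow>
      card {v. v < N \<and> v \<noteq> x \<and> v \<noteq> y \<and> E x v \<and> E y v} < m"
    and blue: "\<And>x y. x < N \<Longrightarrow> y < N \<Longrightarrow> x \<noteq> y \<Longrightarrow> \<not> E x y \<Longrightarrow>
      card {v. v < N \<and> v \<noteq> x \<and> v \<noteq> y \<and> \<not> E x v \<and> \<not> E y v} < n"
  shows "N < ramsey_number (book m) (book n)"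
proof (rule ccontr)
  define r where "r = ramsey_number (book m) (book n)"
  assume "\<not> N < ramsey_number (book m) (book n)"
  then have r: "r \<le> N" by (simp add: r_def)
  define R where "R = {{x, y} | x y. x < r \<and> y < r \<and> x \<noteq> y \<and> E x y}"
  have R: "{x, y} \<in> R \<longleftrightarrow> x < r \<and> y < r \<and> x \<noteq> y \<and> E x y" for x y
    using sympD[OF sym] by (auto simp: R_def doubleton_eq_iff)
  have "ramsey_arrows r (book m) (book n)"
    unfolding r_def using ramsey_number_arrows[OF simple_graph_book simple_graph_book] by blast
  moreover have "R \<subseteq> nsets {..<r} 2" by (auto simp: R_def)
  ultimately consider "contains_copy ({..<r}, R) (book m)" | "contains_copy ({..<r}, nsets {..<r} 2 - R) (book n)"
    unfolding ramsey_arrows_def by blast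
  then show False
  proof cases
    case 1
    then obtain x y where xy: "x < r" "y < r" "x \<noteq> y" "{x, y} \<in> R"
      "m \<le> card ({v \<in> {..<r}. {x, v} \<in> R \<and> {y, v} \<in> R} - {x, y})"
      by (rule contains_bookE) auto
    moreover have "card ({v \<in> {..<r}. {x, v} \<in> R \<and> {y, v} \<in> R} - {x, y})
        \<le> card {v. v < N \<and> v \<noteq> x \<and> v \<noteq> y \<and> E x v \<and> E y v}"
      using r by (intro card_mono) (auto simp: R)
    ultimately show False using red[of x y] r R by simp
  next
    case 2
    then obtain x y where xy: "x < r" "y < r" "x \<noteq> y" "{x, y} \<in> nsets {..<r} 2 - R"
      "n \<le> card ({v \<in> {..<r}. {x, v} \<in> nsets {..<r} 2 - R \<and> {y, v} \<in> nsets {..<r} 2 - R} - {x, y})"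
      by (rule contains_bookE) auto
    moreover have "card ({v \<in> {..<r}. {x, v} \<in> nsets {..<r} 2 - R \<and> {y, v} \<in> nsets {..<r} 2 - R} - {x, y})
        \<le> card {v. v < N \<and> v \<noteq> x \<and> v \<noteq> y \<and> \<not> E x v \<and> \<not> E y v}"
      using r by (intro card_mono) (auto simp: R)
    ultimately show False using blue[of x y] r R by simp
  qed
qed

text \<open>For \<open>N\<close> close to \<open>(3/2 + 3\<alpha> + \<epsilon>)n\<close>, the inequality \<open>6A + 3B < 2N\<close> holds by the choice of the
constant, and \<open>2B < N\<close> because \<open>3/2 + 3\<alpha> \<ge> 2\<close>.\<close>

lemma ramsey_number_books_upper:
  fixes \<alpha> \<epsilon> :: real
  assumes \<alpha>: "1 / 6 \<le> \<alpha>" and \<epsilon>: "0 < \<epsilon>"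
  shows "\<forall>\<^sub>F n in sequentially. real (ramsey_number (book (nat \<lceil>\<alpha> * real n\<rceil>)) (book n))
           \<le> (3 / 2 + 3 * \<alpha> + \<epsilon>) * real n"
proof -
  define c where "c = 3 / 2 + 3 * \<alpha>"
  have c: "2 \<le> c" using \<alpha> by (simp add: c_def)
  define \<delta> where "\<delta> = \<epsilon> / (2 * (c + \<epsilon>))"
  have \<delta>: "0 < \<delta>" using c \<epsilon> by (simp add: \<delta>_def)
  obtain n0 where n0: "\<And>(V :: nat set) E A B. codegree_bounded V E A B \<Longrightarrow>
           6 * A + 3 * B + \<delta> * real (card V) \<le> 2 * real (card V) \<Longrightarrow>
           2 * B + \<delta> * real (card V) \<le> real (card V) \<Longrightarrow> real (card V) < n0"
    using no_large_supercritical[OF \<delta>] by metis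
  (* \<epsilon> * n >= 11 absorbs the rounding errors in N and m *)
  define k where "k = nat \<lceil>max (max n0 1) (11 / \<epsilon>)\<rceil>"
  have "real (ramsey_number (book (nat \<lceil>\<alpha> * real n\<rceil>)) (book n)) \<le> (c + \<epsilon>) * real n" if n: "k \<le> n" for n
  proof -
    define m where "m = nat \<lceil>\<alpha> * real n\<rceil>"
    define N where "N = nat \<lfloor>(c + \<epsilon>) * real n\<rfloor>"
    have big: "n0 \<le> real n" "1 \<le> real n" "11 / \<epsilon> \<le> real n"
      using n by (auto simp: k_def)
    have en: "11 \<le> \<epsilon> * real n" using big(3) \<epsilon> by (simp add: field_simps)
    have m: "real m \<le> \<alpha> * real n + 1"
      using \<alpha> ceiling_correct[of "\<alpha> * real n"] by (simp add: m_def)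
    have pos: "0 \<le> (c + \<epsilon>) * real n" using c \<epsilon> by simp
    have N: "real N \<le> (c + \<epsilon>) * real n" "(c + \<epsilon>) * real n - 1 \<le> real N"
      using pos floor_correct[of "(c + \<epsilon>) * real n"] by (auto simp: N_def)
    have cn: "c * real n = 3 / 2 * real n + 3 * (\<alpha> * real n)" by (simp add: c_def algebra_simps)
    have N2: "c * real n + \<epsilon> * real n - 1 \<le> real N" using N(2) by (simp add: algebra_simps)
    have "2 * real n \<le> c * real n" using c by (intro mult_right_mono) auto
    then have Nn: "2 * real n + \<epsilon> * real n - 1 \<le> real N" using N2 by linarith
    have "\<delta> * real N \<le> \<delta> * ((c + \<epsilon>) * real n)" using N(1) \<delta> by (intro mult_left_mono) auto
    also have "\<dots> = \<delta> * (c + \<epsilon>) * real n" by simp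
    also have "\<delta> * (c + \<epsilon>) = \<epsilon> / 2" using c \<epsilon> by (simp add: \<delta>_def field_simps)
    finally have dN: "\<delta> * real N \<le> \<epsilon> * real n / 2" by simp
    have "ramsey_arrows N (book m) (book n)"
    proof (rule ccontr)
      assume "\<not> ?thesis"
      then obtain E where "codegree_bounded {..<N} E (real m) (real n + 1)"
        using codegree_bounded_if_not_arrows by blast
      moreover have "6 * real m + 3 * (real n + 1) + \<delta> * real N \<le> 2 * real N"
      proof -
        have "6 * real m \<le> 6 * (\<alpha> * real n) + 6" using m by simp
        moreover have "2 * (c * real n) = 3 * real n + 6 * (\<alpha> * real n)" using cn by simp
        ultimately show ?thesis using N2 dN en by argo
      qed
      moreover have "2 * (real n + 1) + \<delta> * real N \<le> real N"
        using Nn dN en by argo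
      ultimately have "real N < n0" using n0[of "{..<N}"] by simp
      then show False using Nn big en by linarith
    qed
    moreover have "0 < N"
    proof -
      have "0 < real N" using Nn big en by linarith
      then show ?thesis by simp
    qed
    ultimately have "ramsey_number (book m) (book n) \<le> N"
      unfolding ramsey_number_def by (intro Least_le) simp
    then show ?thesis using N(1) by (simp add: m_def)
  qed
  then show ?thesis
    unfolding c_def eventually_sequentially by blast
qed

lemma ramsey_number_books_lower_two_cliques:
  assumes "0 < m"
  shows "2 * n < ramsey_number (book m) (book n)"
proof (rule ramsey_number_books_gt)
  let ?E = "\<lambda>x y :: nat. (x < n) \<noteq> (y < n)"
  show "symp ?E" by (auto simp: symp_def)
  fix x y assume xy: "x < 2 * n" "y < 2 * n" "x \<noteq> y"
  show "card {v. v < 2 * n \<and> v \<noteq> x \<and> v \<noteq> y \<and> ?E x v \<and> ?E y v} < m" if "?E x y"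
  proof -
    have "{v. v < 2 * n \<and> v \<noteq> x \<and> v \<noteq> y \<and> ?E x v \<and> ?E y v} = {}" using that by auto
    then show ?thesis using assms by (simp only: card.empty)
  qed
  show "card {v. v < 2 * n \<and> v \<noteq> x \<and> v \<noteq> y \<and> \<not> ?E x v \<and> \<not> ?E y v} < n" if "\<not> ?E x y"
  proof -
    define S where "S = (if x < n then {..<n} else {n..<2 * n})"
    have S: "finite S" "card S = n" "x \<in> S" using xy(1) by (auto simp: S_def)
    have "{v. v < 2 * n \<and> v \<noteq> x \<and> v \<noteq> y \<and> \<not> ?E x v \<and> \<not> ?E y v} \<subseteq> S - {x}"
      by (auto simp: S_def)
    then have "card {v. v < 2 * n \<and> v \<noteq> x \<and> v \<noteq> y \<and> \<not> ?E x v \<and> \<not> ?E y v} \<le> card (S - {x})"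
      using S(1) by (intro card_mono) auto
    also have "\<dots> < card S" using card_Diff1_less[OF S(1,3)] .
    finally show ?thesis unfolding S(2) .
  qed
qed

section \<open>Random colourings\<close>

text \<open>For fixed \<open>x\<close> and \<open>y\<close>, the events for different \<open>v\<close> depend on disjoint pairs of edges, so they are
independent and Hoeffding's inequality applies.\<close>

lemma prob_common_colour:
  fixes q :: real and b :: bool and N x y :: nat
  assumes q: "0 \<le> q" "q \<le> 1" and xy: "x < N" "y < N" "x \<noteq> y" and N: "3 \<le> N" and \<delta>: "0 < \<delta>"
  defines "I \<equiv> nsets {..<N} 2" and "W \<equiv> {..<N} - {x, y}" and "p \<equiv> pmf (bernoulli_pmf q) b"
  shows "measure_pmf.prob (Pi_pmf I False (\<lambda>_. bernoulli_pmf q))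
           {c. (p\<^sup>2 + \<delta>) * real N \<le> real (card {v \<in> W. c {x, v} = b \<and> c {y, v} = b})}
         \<le> exp (- 2 * \<delta>\<^sup>2 * real N)"
proof -
  define PM where "PM = Pi_pmf I False (\<lambda>_. bernoulli_pmf q)"
  define X :: "nat \<Rightarrow> (nat set \<Rightarrow> bool) \<Rightarrow> real"
    where "X v c = of_bool (c {x, v} = b \<and> c {y, v} = b)" for v c
  have finI: "finite I" unfolding I_def by (simp add: finite_imp_finite_nsets)
  have edges: "{x, v} \<in> I" "{y, v} \<in> I" "{x, v} \<noteq> {y, v}" if "v \<in> W" for v
    using that xy by (auto simp: I_def W_def doubleton_eq_iff)
  have "W \<subset> {..<N}" using xy by (auto simp: W_def)
  then have cardW: "card W \<le> N" using card_mono[of "{..<N}" W] by auto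
  have W_pos: "0 < card W" using xy N by (simp add: W_def card_Diff_subset)
  have indep: "prob_space.indep_vars PM (\<lambda>_. borel) X W"
  proof -
    have 1: "prob_space.indep_vars PM (\<lambda>_. count_space UNIV) (\<lambda>e c. c e) I"
      unfolding PM_def by (rule indep_vars_Pi_pmf[OF finI])
    have 2: "prob_space.indep_vars PM (\<lambda>v. PiM {{x, v}, {y, v}} (\<lambda>_. count_space UNIV))
        (\<lambda>v c. restrict (\<lambda>e. c e) {{x, v}, {y, v}}) W"
    proof (rule prob_space.indep_vars_restrict[OF prob_space_measure_pmf 1])
      show "{{x, v}, {y, v}} \<subseteq> I" if "v \<in> W" for v using edges[OF that] by simp
      show "disjoint_family_on (\<lambda>v. {{x, v}, {y, v}}) W"
        by (auto simp: disjoint_family_on_def W_def doubleton_eq_iff)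
    qed
    have "prob_space.indep_vars PM (\<lambda>_. borel) 
        (\<lambda>v c. of_bool ((restrict (\<lambda>e. c e) {{x, v}, {y, v}}) {x, v} = b
                     \<and> (restrict (\<lambda>e. c e) {{x, v}, {y, v}}) {y, v} = b) :: real) W"
      by (rule prob_space.indep_vars_compose2[OF prob_space_measure_pmf 2]) measurable
    then show ?thesis by (simp add: X_def[abs_def])
  qed
  have expX: "measure_pmf.expectation PM (X v) = p\<^sup>2" if v: "v \<in> W" for v
  proof -
    have "measure_pmf.expectation PM (X v) = measure_pmf.prob PM {c. c {x, v} = b \<and> c {y, v} = b}"
    proof -
      have "X v = indicator {c. c {x, v} = b \<and> c {y, v} = b}"
        by (simp add: X_def indicator_def of_bool_def fun_eq_iff)
      then show ?thesis by simp
    qed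
    also have "{c. c {x, v} = b \<and> c {y, v} = b} = Pi I (\<lambda>e. if e \<in> {{x, v}, {y, v}} then {b} else UNIV)"
      using edges[OF v] by (auto simp: Pi_def)
    also have "measure_pmf.prob PM \<dots> = (\<Prod>e\<in>I. measure_pmf.prob (bernoulli_pmf q)
        (if e \<in> {{x, v}, {y, v}} then {b} else UNIV))"
      unfolding PM_def by (rule measure_Pi_pmf_Pi[OF finI])
    also have "\<dots> = (\<Prod>e\<in>{{x, v}, {y, v}}. p)"
      using edges[OF v] finI by (intro prod.mono_neutral_cong_right) (auto simp: p_def measure_pmf_single)
    also have "\<dots> = p\<^sup>2" using edges[OF v] by (simp add: power2_eq_square)
    finally show ?thesis .
  qed
  interpret H: Hoeffding_ineq PM W X "\<lambda>_. 0" "\<lambda>_. 1" "\<Sum>v\<in>W. measure_pmf.expectation PM (X v)"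
  proof unfold_locales
    show "finite W" by (simp add: W_def)
    show "prob_space.indep_vars PM (\<lambda>_. borel) X W" by (rule indep)
    show "AE c in PM. X v c \<in> {0..1}" for v by (simp add: X_def)
  qed
  have \<mu>: "(\<Sum>v\<in>W. measure_pmf.expectation PM (X v)) = real (card W) * p\<^sup>2" by (simp add: expX)
  have sumX: "(\<Sum>v\<in>W. X v c) = real (card {v \<in> W. c {x, v} = b \<and> c {y, v} = b})" for c
    by (simp add: X_def W_def Int_def)
  have "real (card W) * p\<^sup>2 + \<delta> * real N \<le> (p\<^sup>2 + \<delta>) * real N"
    using mult_right_mono[of "real (card W)" "real N" "p\<^sup>2"] cardW by (simp add: algebra_simps)
  then have "measure_pmf.prob PM {c. (p\<^sup>2 + \<delta>) * real N \<le> real (card {v \<in> W. c {x, v} = b \<and> c {y, v} = b})}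
      \<le> measure_pmf.prob PM {c \<in> space PM. (\<Sum>v\<in>W. measure_pmf.expectation PM (X v)) + \<delta> * real N \<le> (\<Sum>v\<in>W. X v c)}"
    unfolding \<mu> sumX by (intro measure_pmf.finite_measure_mono) auto
  also have "\<dots> \<le> exp (- 2 * (\<delta> * real N)\<^sup>2 / (\<Sum>v\<in>W. (1 - 0)\<^sup>2))"
    by (rule H.Hoeffding_ineq_ge) (use \<delta> W_pos in auto)
  also have "\<dots> \<le> exp (- 2 * \<delta>\<^sup>2 * real N)"
  proof -
    have "real (card W) * (\<delta>\<^sup>2 * real N) \<le> real N * (\<delta>\<^sup>2 * real N)"
      using cardW by (intro mult_right_mono) auto
    then show ?thesis using W_pos by (simp add: field_simps power2_eq_square)
  qed
  finally show ?thesis unfolding PM_def .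
qed

text \<open>A union bound over the fewer than \<open>2N\<^sup>2\<close> choices of two vertices and a colour.\<close>

lemma ex_quasirandom_colouring:
  fixes q \<delta> :: real
  assumes q: "0 \<le> q" "q \<le> 1" and \<delta>: "0 < \<delta>"
  shows "\<forall>\<^sub>F N in sequentially. \<exists>E :: nat \<Rightarrow> nat \<Rightarrow> bool. symp E \<and> (\<forall>x<N. \<forall>y<N. x \<noteq> y \<longrightarrow>
     real (card {v. v < N \<and> v \<noteq> x \<and> v \<noteq> y \<and> E x v \<and> E y v}) < (q\<^sup>2 + \<delta>) * real N \<and>
     real (card {v. v < N \<and> v \<noteq> x \<and> v \<noteq> y \<and> \<not> E x v \<and> \<not> E y v}) < ((1 - q)\<^sup>2 + \<delta>) * real N)"
proof -
  have "\<forall>\<^sub>F N in sequentially. real N * real N * 2 * exp (- 2 * \<delta>\<^sup>2 * real N) < 1"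
    using \<delta> by real_asymp
  with eventually_ge_at_top[of 3] show ?thesis
  proof eventually_elim
    case (elim N)
    define I where "I = nsets {..<N} 2"
    define PM where "PM = Pi_pmf I False (\<lambda>_. bernoulli_pmf q)"
    define p where "p b = pmf (bernoulli_pmf q) b" for b
    define Bad where "Bad x y b = {c. ((p b)\<^sup>2 + \<delta>) * real N
        \<le> real (card {v \<in> {..<N} - {x, y}. c {x, v} = b \<and> c {y, v} = b})}" for x y b
    define J where "J = {(x, y, b :: bool). x < N \<and> y < N \<and> x \<noteq> y}"
    have JS: "J \<subseteq> {..<N} \<times> {..<N} \<times> UNIV" by (auto simp: J_def)
    then have finJ: "finite J" by (rule finite_subset) simp
    have "card J \<le> card ({..<N} \<times> {..<N} \<times> (UNIV :: bool set))" using JS by (intro card_mono) auto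
    then have cardJ: "real (card J) \<le> real N * real N * 2"
    proof -
      have "card ({..<N} \<times> {..<N} \<times> (UNIV :: bool set)) = N * N * 2"
        by (simp add: card_cartesian_product)
      then have "real (card J) \<le> real (N * N * 2)"
        using \<open>card J \<le> _\<close> unfolding of_nat_le_iff by simp
      then show ?thesis by simp
    qed
    have "measure_pmf.prob PM (\<Union>(x, y, b)\<in>J. Bad x y b) \<le> (\<Sum>(x, y, b)\<in>J. measure_pmf.prob PM (Bad x y b))"
      using measure_pmf.finite_measure_subadditive_finite[OF finJ, of "\<lambda>(x, y, b). Bad x y b" PM]
      by (simp add: split_def)
    also have "\<dots> \<le> (\<Sum>j\<in>J. exp (- 2 * \<delta>\<^sup>2 * real N))"
      using prob_common_colour[OF q _ _ _ elim(1) \<delta>]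
      by (intro sum_mono) (auto simp: J_def PM_def I_def Bad_def p_def)
    also have "\<dots> \<le> real N * real N * 2 * exp (- 2 * \<delta>\<^sup>2 * real N)"
      using cardJ by (simp add: mult_right_mono)
    also have "\<dots> < 1" by (rule elim(2))
    finally have "(\<Union>(x, y, b)\<in>J. Bad x y b) \<noteq> UNIV"
      using measure_pmf.prob_space[of PM] by auto
    then obtain c where c: "\<And>x y b. (x, y, b) \<in> J \<Longrightarrow> c \<notin> Bad x y b" by auto
    have eq: "{v. v < N \<and> v \<noteq> x \<and> v \<noteq> y \<and> P v} = {v \<in> {..<N} - {x, y}. P v}" for P x y by auto
    have "p True = q" "p False = 1 - q" using q by (simp_all add: p_def)
    then have good: "real (card {v. v < N \<and> v \<noteq> x \<and> v \<noteq> y \<and> c {x, v} \<and> c {y, v}}) < (q\<^sup>2 + \<delta>) * real N"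
      "real (card {v. v < N \<and> v \<noteq> x \<and> v \<noteq> y \<and> \<not> c {x, v} \<and> \<not> c {y, v}}) < ((1 - q)\<^sup>2 + \<delta>) * real N"
      if "x < N" "y < N" "x \<noteq> y" for x y
      using c[of x y True] c[of x y False] that unfolding J_def Bad_def eq by (simp_all add: not_le)
    show ?case
    proof (intro exI[of _ "\<lambda>x y. c {x, y}"] conjI allI impI)
      show "symp (\<lambda>x y. c {x, y})" by (simp add: symp_def insert_commute)
    qed (use good in blast)+
  qed
qed

section \<open>Ramsey numbers of books\<close>

text \<open>Red density \<open>1/3\<close> makes both conditions tight at the same size: with \<open>N = 9n/4\<close> the codegrees
\<open>N/9\<close> and \<open>4N/9\<close> are \<open>n/4\<close> and \<open>n\<close>.\<close>

lemma ramsey_number_books_lower_random: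
  fixes \<epsilon> :: real
  assumes \<epsilon>: "0 < \<epsilon>"
  shows "\<forall>\<^sub>F n in sequentially. (9 / 4 - \<epsilon>) * real n
           \<le> real (ramsey_number (book (nat \<lceil>1 / 4 * real n\<rceil>)) (book n))"
proof (cases "\<epsilon> < 2")
  case False
  show ?thesis
  proof (intro always_eventually allI)
    fix n
    show "(9 / 4 - \<epsilon>) * real n \<le> real (ramsey_number (book (nat \<lceil>1 / 4 * real n\<rceil>)) (book n))"
    proof (cases "n = 0")
      case True
      then show ?thesis by simp
    next
      case n: False
      then have "2 * n < ramsey_number (book (nat \<lceil>1 / 4 * real n\<rceil>)) (book n)"
        by (intro ramsey_number_books_lower_two_cliques) simp
      moreover have "(9 / 4 - \<epsilon>) * real n \<le> 1 / 4 * real n"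
        using False by (intro mult_right_mono) auto
      ultimately show ?thesis by linarith
    qed
  qed
next
  case True
  define c where "c = 9 / 4 - \<epsilon>"
  have c: "0 < c" "c < 9 / 4" using True \<epsilon> by (simp_all add: c_def)
  (* the codegree errors \<delta> * 9/4 stay below \<epsilon>/9, the room won by the smaller N *)
  define \<delta> where "\<delta> = \<epsilon> / 40"
  have \<delta>: "0 < \<delta>" using \<epsilon> by (simp add: \<delta>_def)
  have "filterlim (\<lambda>n::nat. nat \<lfloor>c * real n\<rfloor>) sequentially sequentially"
    using c by real_asymp
  from eventually_compose_filterlim[OF ex_quasirandom_colouring[of "1 / 3" \<delta>] this] \<delta>
  have "\<forall>\<^sub>F n in sequentially. \<exists>E :: nat \<Rightarrow> nat \<Rightarrow> bool. symp E \<and>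
     (\<forall>x<nat \<lfloor>c * real n\<rfloor>. \<forall>y<nat \<lfloor>c * real n\<rfloor>. x \<noteq> y \<longrightarrow>
     real (card {v. v < nat \<lfloor>c * real n\<rfloor> \<and> v \<noteq> x \<and> v \<noteq> y \<and> E x v \<and> E y v})
       < ((1 / 3)\<^sup>2 + \<delta>) * real (nat \<lfloor>c * real n\<rfloor>) \<and>
     real (card {v. v < nat \<lfloor>c * real n\<rfloor> \<and> v \<noteq> x \<and> v \<noteq> y \<and> \<not> E x v \<and> \<not> E y v})
       < ((1 - 1 / 3)\<^sup>2 + \<delta>) * real (nat \<lfloor>c * real n\<rfloor>))"
    by simp
  then show ?thesis
  proof eventually_elim
    case (elim n)
    define N where "N = nat \<lfloor>c * real n\<rfloor>"
    have pos: "0 \<le> c * real n" using c by simp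
    have N: "real N \<le> c * real n" "c * real n < real N + 1"
      using pos floor_correct[of "c * real n"] by (auto simp: N_def)
    obtain E where E: "symp E" and codeg: "\<And>x y. x < N \<Longrightarrow> y < N \<Longrightarrow> x \<noteq> y \<Longrightarrow>
        real (card {v. v < N \<and> v \<noteq> x \<and> v \<noteq> y \<and> E x v \<and> E y v}) < ((1 / 3)\<^sup>2 + \<delta>) * real N \<and>
        real (card {v. v < N \<and> v \<noteq> x \<and> v \<noteq> y \<and> \<not> E x v \<and> \<not> E y v}) < ((1 - 1 / 3)\<^sup>2 + \<delta>) * real N"
      using elim unfolding N_def[symmetric] by blast
    have "\<delta> * c \<le> \<epsilon> / 40 * (9 / 4)" using c \<epsilon> unfolding \<delta>_def by (intro mult_left_mono) auto
    then have \<delta>c: "c / 9 + \<delta> * c \<le> 1 / 4" "4 / 9 * c + \<delta> * c \<le> 1"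
      using \<epsilon> c_def by linarith+
    have "((1 / 3)\<^sup>2 + \<delta>) * real N \<le> ((1 / 3)\<^sup>2 + \<delta>) * (c * real n)"
      using N(1) \<delta> by (intro mult_left_mono) auto
    also have "\<dots> = (c / 9 + \<delta> * c) * real n" by (simp add: power2_eq_square algebra_simps)
    also have "\<dots> \<le> 1 / 4 * real n"
      using \<delta>c by (intro mult_right_mono) auto
    also have "\<dots> \<le> real (nat \<lceil>1 / 4 * real n\<rceil>)" by linarith
    finally have red: "((1 / 3)\<^sup>2 + \<delta>) * real N \<le> real (nat \<lceil>1 / 4 * real n\<rceil>)" .
    have "((1 - 1 / 3)\<^sup>2 + \<delta>) * real N \<le> ((1 - 1 / 3)\<^sup>2 + \<delta>) * (c * real n)"
      using N(1) \<delta> by (intro mult_left_mono) auto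
    also have "\<dots> = (4 / 9 * c + \<delta> * c) * real n" by (simp add: power2_eq_square algebra_simps)
    also have "\<dots> \<le> 1 * real n"
      using \<delta>c by (intro mult_right_mono) auto
    finally have blue: "((1 - 1 / 3)\<^sup>2 + \<delta>) * real N \<le> real n" by simp
    have "N < ramsey_number (book (nat \<lceil>1 / 4 * real n\<rceil>)) (book n)"
    proof (rule ramsey_number_books_gt[OF E])
      fix x y assume xy: "x < N" "y < N" "x \<noteq> y"
      show "card {v. v < N \<and> v \<noteq> x \<and> v \<noteq> y \<and> E x v \<and> E y v} < nat \<lceil>1 / 4 * real n\<rceil>"
        using codeg[OF xy] red by linarith
      show "card {v. v < N \<and> v \<noteq> x \<and> v \<noteq> y \<and> \<not> E x v \<and> \<not> E y v} < n"
        using codeg[OF xy] blue by linarith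
    qed
    then show ?case using N(2) by (simp add: c_def)
  qed
qed

theorem theorem1p5:
  fixes \<alpha> :: real
  assumes "1 / 6 \<le> \<alpha>" and "\<alpha> \<le> 1 / 4"
  shows "(\<exists>h \<in> o(\<lambda>n::nat. real n). \<forall>\<^sub>F n in sequentially.
            real (ramsey_number (book (nat \<lceil>\<alpha> * real n\<rceil>)) (book n))
              \<le> (3 / 2 + 3 * \<alpha>) * real n + h n)
       \<and> (\<alpha> = 1 / 6 \<or> \<alpha> = 1 / 4 \<longrightarrow>
            (\<exists>h \<in> o(\<lambda>n::nat. real n). \<forall>\<^sub>F n in sequentially.
              real (ramsey_number (book (nat \<lceil>\<alpha> * real n\<rceil>)) (book n))
                = (3 / 2 + 3 * \<alpha>) * real n + h n))"
proof -
  define r where "r n = real (ramsey_number (book (nat \<lceil>\<alpha> * real n\<rceil>)) (book n))" for n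
  define c where "c = 3 / 2 + 3 * \<alpha>"
  have upper: "\<forall>\<^sub>F n in sequentially. r n \<le> (c + \<epsilon>) * real n" if "0 < \<epsilon>" for \<epsilon>
    using ramsey_number_books_upper[OF assms(1) that] by (simp add: r_def c_def)
  have "(\<lambda>n. max 0 (r n - c * real n)) \<in> o(\<lambda>n. real n)"
  proof (rule landau_o.smallI)
    fix \<epsilon> :: real assume "0 < \<epsilon>"
    then show "\<forall>\<^sub>F n in sequentially. norm (max 0 (r n - c * real n)) \<le> \<epsilon> * norm (real n)"
      using upper[of \<epsilon>] by (auto elim!: eventually_mono simp: algebra_simps)
  qed
  moreover have "\<forall>\<^sub>F n in sequentially. r n \<le> c * real n + max 0 (r n - c * real n)"
    by (intro always_eventually) auto
  ultimately have 1: "\<exists>h \<in> o(\<lambda>n. real n). \<forall>\<^sub>F n in sequentially. r n \<le> c * real n + h n"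
    by (intro bexI)
  have 2: "\<exists>h \<in> o(\<lambda>n. real n). \<forall>\<^sub>F n in sequentially. r n = c * real n + h n"
    if \<alpha>: "\<alpha> = 1 / 6 \<or> \<alpha> = 1 / 4"
  proof -
    have lower: "\<forall>\<^sub>F n in sequentially. (c - \<epsilon>) * real n \<le> r n" if \<epsilon>: "0 < \<epsilon>" for \<epsilon>
      using \<alpha>
    proof
      assume \<alpha>: "\<alpha> = 1 / 6"
      have "(c - \<epsilon>) * real n \<le> r n" if "0 < n" for n
      proof -
        have "2 * n < ramsey_number (book (nat \<lceil>\<alpha> * real n\<rceil>)) (book n)"
          using that by (intro ramsey_number_books_lower_two_cliques) (simp add: \<alpha>)
        then have "2 * real n \<le> r n" by (simp add: r_def)
        moreover have "(c - \<epsilon>) * real n \<le> 2 * real n"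
          using \<epsilon> by (intro mult_right_mono) (auto simp: c_def \<alpha>)
        ultimately show ?thesis by linarith
      qed
      then show ?thesis by (auto intro: eventually_mono[OF eventually_gt_at_top[of 0]])
    next
      assume \<alpha>: "\<alpha> = 1 / 4"
      then have "c = 9 / 4" by (simp add: c_def)
      then show ?thesis
        using ramsey_number_books_lower_random[OF \<epsilon>] by (simp only: r_def \<alpha>)
    qed
    have "(\<lambda>n. r n - c * real n) \<in> o(\<lambda>n. real n)"
    proof (rule landau_o.smallI)
      fix \<epsilon> :: real assume "0 < \<epsilon>"
      from eventually_conj[OF upper[OF this] lower[OF this]]
      show "\<forall>\<^sub>F n in sequentially. norm (r n - c * real n) \<le> \<epsilon> * norm (real n)"
        by (rule eventually_mono) (auto simp: algebra_simps abs_le_iff)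
    qed
    then show ?thesis by (intro bexI) simp_all
  qed
  show ?thesis
    using 1 2 unfolding r_def c_def by blast
qed

end
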